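(* Fix $\beta_1\in\mathbb R$. For $\beta_2\in\mathbb R$ and a graphon $W$ let $T_\wedge(W)=\beta_1t(K_2,W)+\beta_2t_{\mathrm{ind}}(K_{1,2},W)$, and let $$\psi_\wedge(\beta_2)=\sup_{\widetilde W\in\widetilde{\mathcal W}}\Big\{T_\wedge(W)-\tfrac12\mathcal I(W)\Big\},\qquad \mathcal M^*_\wedge(\beta_2)=\operatorname*{arg\,max}_{\widetilde W\in\widetilde{\mathcal W}}\Big\{T_\wedge(W)-\tfrac12\mathcal I(W)\Big\}.$$ Then $$\lim_{\beta_2\to-\infty}\ \sup_{\widetilde W\in\mathcal M^*_\wedge(\beta_2)}\delta_\square(\widetilde W,\mathcal N^*_\wedge)=0,$$ where $$\mathcal N^*_\wedge=\begin{cases}\{W\equiv0\}&\text{if }\beta_1<0,\\ \widetilde{\mathcal W}_{\mathrm{clus}}&\text{if }\beta_1=0,\\ \{W\equiv1\}&\text{if }\beta_1>0.\end{cases}$$ Moreover, $\lim_{\beta_2\to-\infty}\psi_\wedge(\beta_2)=0$ if $\beta_1\le0$, and $\lim_{\beta_2\to-\infty}\psi_\wedge(\beta_2)=\beta_1$ if $\beta_1>0$.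
   Context: A graphon is a measurable symmetric function $W:[0,1]^2\to[0,1]$. Cut distance: $\delta_\square(U,W)=\inf_\phi\sup_{S,T\subset[0,1]}|\int_{S\times T}(U(x,y)-W(\phi(x),\phi(y)))\,dx\,dy|$ over measure-preserving bijections $\phi$ of $[0,1]$. $\widetilde{\mathcal W}$ is the set of graphons modulo $\delta_\square=0$; $\widetilde W$ is the class of $W$; $\delta_\square(\widetilde W,A)=\inf_{\widetilde U\in A}\delta_\square(\widetilde W,\widetilde U)$. All functionals below depend only on the class. $W\equiv p$ denotes the (class of the) constant graphon $p$. $t(K_2,W)=\int_{[0,1]^2}W(x,y)\,dx\,dy$; $t_{\mathrm{ind}}(K_{1,2},W)=\int_{[0,1]^3}W(x,y)W(x,z)(1-W(y,z))\,dx\,dy\,dz$; $\mathcal I(W)=\int_{[0,1]^2}\big[W\log W+(1-W)\log(1-W)\big]dx\,dy$ with $0\log0=0$. A cluster graphon is a graphon of the form $W(x,y)=\sum_{i\ge1}\mathbf 1\{(x,y)\in A_i\times A_i\}$ for pairwise disjoint measurable sets $A_1,A_2,\dots\subseteq[0,1]$ (possibly null or empty, and not necessarily covering $[0,1]$). $\widetilde{\mathcal W}_{\mathrm{clus}}\subseteq\widetilde{\mathcal W}$ is the set of equivalence classes of cluster graphons. *)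

theory Defs
  imports "HOL-Analysis.Analysis"
begin

text \<open>
  A graphon is a curried function on the reals of which only the values on the unit square
  matter: two functions agreeing there are at cut distance 0.  Measurability is Borel
  measurability; a Lebesgue measurable graphon is almost everywhere equal to a Borel one, so the
  classes modulo cut distance 0 are the same.
\<close>

abbreviation unit_lborel :: "real measure" where
  "unit_lborel \<equiv> restrict_space lborel {0..1}"

definition graphon :: "(real \<Rightarrow> real \<Rightarrow> real) \<Rightarrow> bool" where
  "graphon W \<longleftrightarrow>
     (\<lambda>(x, y). W x y) \<in> borel_measurable (unit_lborel \<Otimes>\<^sub>M unit_lborel) \<and>
     (\<forall>x\<in>{0..1}. \<forall>y\<in>{0..1}. W x y = W y x \<and> 0 \<le> W x y \<and> W x y \<le> 1)"

text \<open>
  As usual, the inverse of a measure-preserving bijection is required to be measurable as well;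
  it then preserves the measure automatically.
\<close>

definition mp_bijections :: "(real \<Rightarrow> real) set" where
  "mp_bijections = {\<phi>. bij_betw \<phi> {0..1} {0..1} \<and>
     \<phi> \<in> measurable unit_lborel unit_lborel \<and>
     inv_into {0..1} \<phi> \<in> measurable unit_lborel unit_lborel \<and>
     distr unit_lborel unit_lborel \<phi> = unit_lborel}"

definition cut_norm :: "(real \<Rightarrow> real \<Rightarrow> real) \<Rightarrow> real" where
  "cut_norm f = (SUP (S, T) \<in> sets unit_lborel \<times> sets unit_lborel.
     \<bar>LINT p:S \<times> T|(unit_lborel \<Otimes>\<^sub>M unit_lborel). f (fst p) (snd p)\<bar>)"

definition cut_dist :: "(real \<Rightarrow> real \<Rightarrow> real) \<Rightarrow> (real \<Rightarrow> real \<Rightarrow> real) \<Rightarrow> real" where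
  "cut_dist U W = (INF \<phi> \<in> mp_bijections. cut_norm (\<lambda>x y. U x y - W (\<phi> x) (\<phi> y)))"

type_synonym graphon_class = "(real \<Rightarrow> real \<Rightarrow> real) set"

definition graphon_rel :: "((real \<Rightarrow> real \<Rightarrow> real) \<times> (real \<Rightarrow> real \<Rightarrow> real)) set" where
  "graphon_rel = {(U, W). graphon U \<and> graphon W \<and> cut_dist U W = 0}"

definition graphon_space :: "graphon_class set" where
  "graphon_space = {W. graphon W} // graphon_rel"

definition class_of :: "(real \<Rightarrow> real \<Rightarrow> real) \<Rightarrow> graphon_class" where
  "class_of W = graphon_rel `` {W}"

text \<open>
  Functionals of graphons that depend only on the class are transported to classes by evaluation
  at a representative.
\<close>

definition rep :: "graphon_class \<Rightarrow> real \<Rightarrow> real \<Rightarrow> real" where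
  "rep C = (SOME W. W \<in> C)"

definition class_dist :: "graphon_class \<Rightarrow> graphon_class \<Rightarrow> real" where
  "class_dist C D = cut_dist (rep C) (rep D)"

definition class_setdist :: "graphon_class \<Rightarrow> graphon_class set \<Rightarrow> real" where
  "class_setdist C A = (INF D \<in> A. class_dist C D)"

definition t_edge :: "(real \<Rightarrow> real \<Rightarrow> real) \<Rightarrow> real" where
  "t_edge W = (LINT (x, y)|(unit_lborel \<Otimes>\<^sub>M unit_lborel). W x y)"

definition t_ind_cherry :: "(real \<Rightarrow> real \<Rightarrow> real) \<Rightarrow> real" where
  "t_ind_cherry W = (LINT (x, y, z)|(unit_lborel \<Otimes>\<^sub>M unit_lborel \<Otimes>\<^sub>M unit_lborel).
     W x y * W x z * (1 - W y z))"

text \<open>The convention \<open>0 log 0 = 0\<close> is automatic, the factor in front being 0.\<close>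

definition graphon_entropy :: "(real \<Rightarrow> real \<Rightarrow> real) \<Rightarrow> real" where
  "graphon_entropy W = (LINT (x, y)|(unit_lborel \<Otimes>\<^sub>M unit_lborel).
     W x y * ln (W x y) + (1 - W x y) * ln (1 - W x y))"

definition cluster_graphon :: "(real \<Rightarrow> real \<Rightarrow> real) \<Rightarrow> bool" where
  "cluster_graphon W \<longleftrightarrow> graphon W \<and>
     (\<exists>A :: nat \<Rightarrow> real set. (\<forall>i. A i \<in> sets unit_lborel) \<and> disjoint_family A \<and>
        (\<forall>x\<in>{0..1}. \<forall>y\<in>{0..1}. W x y = (\<Sum>i. indicator (A i \<times> A i) (x, y))))"

definition cluster_classes :: "graphon_class set" where
  "cluster_classes = class_of ` {W. cluster_graphon W}"

definition T_wedge :: "real \<Rightarrow> real \<Rightarrow> (real \<Rightarrow> real \<Rightarrow> real) \<Rightarrow> real" where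
  "T_wedge \<beta>1 \<beta>2 W = \<beta>1 * t_edge W + \<beta>2 * t_ind_cherry W"

definition free_energy :: "real \<Rightarrow> real \<Rightarrow> graphon_class \<Rightarrow> real" where
  "free_energy \<beta>1 \<beta>2 C = T_wedge \<beta>1 \<beta>2 (rep C) - 1 / 2 * graphon_entropy (rep C)"

definition psi_wedge :: "real \<Rightarrow> real \<Rightarrow> real" where
  "psi_wedge \<beta>1 \<beta>2 = (SUP C \<in> graphon_space. free_energy \<beta>1 \<beta>2 C)"

definition maximizers :: "real \<Rightarrow> real \<Rightarrow> graphon_class set" where
  "maximizers \<beta>1 \<beta>2 =
     {C \<in> graphon_space. \<forall>D \<in> graphon_space. free_energy \<beta>1 \<beta>2 D \<le> free_energy \<beta>1 \<beta>2 C}"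

definition limit_classes :: "real \<Rightarrow> graphon_class set" where
  "limit_classes \<beta>1 =
     (if \<beta>1 < 0 then {class_of (\<lambda>x y. 0)}
      else if \<beta>1 = 0 then cluster_classes
      else {class_of (\<lambda>x y. 1)})"

end

theory Submission
  imports Defs "HOL-Probability.Probability_Measure"
begin

text \<open>
  A graphon with small induced cherry density is \<open>L\<^sup>1\<close>-close to a cluster graphon, and this replaces
  any compactness argument.  Fix a threshold \<open>\<theta>\<close> and choose random pivots \<open>x\<close>; each takes as its
  cluster all still unassigned \<open>y\<close> with \<open>W x y \<ge> \<theta>\<close>.  The expected \<open>L\<^sup>1\<close> error caused by one
  pivot is at most \<open>3 / \<theta>\<^sup>2\<close> times the cherry density, and after \<open>k\<close> pivots the points not yet
  assigned carry edge weight at most \<open>1 / (k + 1) + \<theta>\<close> in expectation.  Closeness to a 0-1-valued graphon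
  forces the entropy to be small (Gibbs' inequality).  A graphon of nonnegative energy has cherry
  density \<open>O(1 / \<bar>\<beta>\<^sub>2\<bar>)\<close>, so as \<open>\<beta>\<^sub>2 \<rightarrow> -\<infinity>\<close> its energy is at most \<open>\<beta>\<^sub>1 t(K\<^sub>2, W) + o(1)\<close>,
  whereas the constant graphons 0 and 1 show that the maximum is at least \<open>max 0 \<beta>\<^sub>1\<close>.
\<close>

section \<open>Integration over the unit interval, square and cube\<close>

abbreviation unit_square :: "(real \<times> real) measure" where
  "unit_square \<equiv> unit_lborel \<Otimes>\<^sub>M unit_lborel"

abbreviation unit_cube :: "(real \<times> real \<times> real) measure" where
  "unit_cube \<equiv> unit_lborel \<Otimes>\<^sub>M unit_square"

lemma prob_space_unit_lborel: "prob_space unit_lborel"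
  by (rule prob_spaceI) (simp add: space_restrict_space emeasure_restrict_space)

interpretation unit: prob_space unit_lborel
  by (rule prob_space_unit_lborel)

interpretation square: pair_prob_space unit_lborel unit_lborel ..

interpretation cube: pair_prob_space unit_lborel unit_square ..

lemma space_unit_lborel [simp]: "space unit_lborel = {0..1}"
  by (simp add: space_restrict_space)

lemma measure_unit_interval [simp]: "measure unit_lborel {0..1} = 1"
  using unit.prob_space by simp

lemma (in prob_space) integrable_bounded:
  fixes f :: "'a \<Rightarrow> real"
  assumes "f \<in> borel_measurable M" "\<And>p. p \<in> space M \<Longrightarrow> \<bar>f p\<bar> \<le> B"
  shows "integrable M f"
  using assms by (intro integrable_const_bound[of _ B]) auto

lemma (in prob_space) abs_expectation_le:
  fixes f :: "'a \<Rightarrow> real"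
  assumes "f \<in> borel_measurable M" and bd: "\<And>p. p \<in> space M \<Longrightarrow> \<bar>f p\<bar> \<le> B"
  shows "\<bar>expectation f\<bar> \<le> B"
proof -
  have "\<bar>expectation f\<bar> \<le> expectation (\<lambda>p. \<bar>f p\<bar>)"
    by (rule integral_abs_bound)
  also have "\<dots> \<le> B"
    using integrable_bounded[OF assms] bd by (intro integral_le_const AE_I2) auto
  finally show ?thesis .
qed

text \<open>First-moment principle: if f exceeded its mean everywhere, integrating the strict
  inequality would put the mean above itself. It serves to pick one good pivot out of an average
  over all pivots.\<close>

lemma (in prob_space) exists_le_expectation:
  fixes f :: "'a \<Rightarrow> real"
  assumes "integrable M f"
  obtains x where "x \<in> space M" "f x \<le> expectation f"
proof (rule ccontr)
  assume "\<not> thesis"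
  then have "AE x in M. expectation f < f x"
    using that by (intro AE_I2) force
  then have "expectation (\<lambda>_. expectation f) < expectation f"
    using assms by (intro integral_less_AE_space) (auto simp: emeasure_space_1)
  then show False
    by (simp add: prob_space)
qed

lemma integrable_squareI:
  fixes f :: "real \<Rightarrow> real \<Rightarrow> real"
  assumes "(\<lambda>(x, y). f x y) \<in> borel_measurable unit_square"
    and "\<And>x y. x \<in> {0..1} \<Longrightarrow> y \<in> {0..1} \<Longrightarrow> \<bar>f x y\<bar> \<le> B"
  shows "integrable unit_square (\<lambda>(x, y). f x y)"
  using assms by (intro square.integrable_bounded[of _ B]) (auto simp: space_pair_measure)

lemma integrable_cubeI:
  fixes f :: "real \<Rightarrow> real \<Rightarrow> real \<Rightarrow> real"
  assumes "(\<lambda>(x, y, z). f x y z) \<in> borel_measurable unit_cube"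
    and "\<And>x y z. x \<in> {0..1} \<Longrightarrow> y \<in> {0..1} \<Longrightarrow> z \<in> {0..1} \<Longrightarrow> \<bar>f x y z\<bar> \<le> B"
  shows "integrable unit_cube (\<lambda>(x, y, z). f x y z)"
  using assms by (intro cube.integrable_bounded[of _ B]) (auto simp: space_pair_measure)

section \<open>Graphons and the induced cherry density\<close>

lemma graphon_measurable:
  "graphon W \<Longrightarrow> (\<lambda>(x, y). W x y) \<in> borel_measurable unit_square"
  by (simp add: graphon_def)

lemma graphon_sym: "graphon W \<Longrightarrow> x \<in> {0..1} \<Longrightarrow> y \<in> {0..1} \<Longrightarrow> W x y = W y x"
  by (simp add: graphon_def)

lemma graphon_bounds:
  assumes "graphon W" "x \<in> {0..1}" "y \<in> {0..1}"
  shows "0 \<le> W x y" "W x y \<le> 1"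
  using assms by (simp_all add: graphon_def)

text \<open>The first argument is the centre of the cherry and the other two are its ends. The three
  arguments are kept apart because errors will be charged to cherries with different
  centres.\<close>

definition cherry :: "(real \<Rightarrow> real \<Rightarrow> real) \<Rightarrow> real \<Rightarrow> real \<Rightarrow> real \<Rightarrow> real" where
  "cherry W x y z = W x y * W x z * (1 - W y z)"

lemma cherry_bounds:
  assumes "graphon W" "x \<in> {0..1}" "y \<in> {0..1}" "z \<in> {0..1}"
  shows "0 \<le> cherry W x y z" "cherry W x y z \<le> W x y" "cherry W x y z \<le> 1 - W y z"
    "\<bar>cherry W x y z\<bar> \<le> 1"
proof -
  note b = graphon_bounds[OF assms(1)]
  have w: "0 \<le> W x y" "W x y \<le> 1" "0 \<le> W x z" "W x z \<le> 1" "0 \<le> 1 - W y z" "1 - W y z \<le> 1"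
    using b assms by auto
  have p: "0 \<le> W x y * W x z" "W x y * W x z \<le> W x y" "W x y * W x z \<le> 1"
    using w by (auto simp: mult_left_le mult_le_one)
  show "0 \<le> cherry W x y z"
    unfolding cherry_def using p w by simp
  show 2: "cherry W x y z \<le> W x y"
    unfolding cherry_def using p w by (meson mult_left_le order_trans)
  show "cherry W x y z \<le> 1 - W y z"
    unfolding cherry_def using p w by (simp add: mult_left_le_one_le)
  show "\<bar>cherry W x y z\<bar> \<le> 1"
    using \<open>0 \<le> cherry W x y z\<close> 2 w by linarith
qed

lemma cherry_measurable:
  assumes "graphon W" and [measurable]: "f \<in> measurable N unit_lborel"
    "g \<in> measurable N unit_lborel" "h \<in> measurable N unit_lborel"
  shows "(\<lambda>p. cherry W (f p) (g p) (h p)) \<in> borel_measurable N"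
proof -
  note graphon_measurable[OF assms(1), measurable]
  show ?thesis
    unfolding cherry_def by measurable
qed

lemma t_ind_cherry_eq: "t_ind_cherry W = (\<integral>(x, y, z). cherry W x y z \<partial>unit_cube)"
  by (simp add: t_ind_cherry_def cherry_def)

lemma integral_cube_swap23:
  fixes f :: "real \<Rightarrow> real \<Rightarrow> real \<Rightarrow> real"
  assumes [measurable]: "(\<lambda>(x, y, z). f x y z) \<in> borel_measurable unit_cube"
    and bd: "\<And>x y z. x \<in> {0..1} \<Longrightarrow> y \<in> {0..1} \<Longrightarrow> z \<in> {0..1} \<Longrightarrow> \<bar>f x y z\<bar> \<le> B"
  shows "(\<integral>(x, y, z). f x z y \<partial>unit_cube) = (\<integral>(x, y, z). f x y z \<partial>unit_cube)"
proof -
  have m: "(\<lambda>(x, y, z). f x z y) \<in> borel_measurable unit_cube"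
    using measurable_compose[OF _ assms(1), of "\<lambda>(x, y, z). (x, z, y)" unit_cube]
    by (simp add: case_prod_beta)
  have "(\<integral>(x, y, z). f x z y \<partial>unit_cube) = (\<integral>x. \<integral>(y, z). f x z y \<partial>unit_square \<partial>unit_lborel)"
    using m bd by (subst cube.integral_fst'[symmetric])
      (auto intro!: cube.integrable_bounded[of _ B] simp: space_pair_measure)
  also have "\<dots> = (\<integral>x. \<integral>(y, z). f x y z \<partial>unit_square \<partial>unit_lborel)"
  proof (rule Bochner_Integration.integral_cong[OF refl])
    fix x :: real assume "x \<in> space unit_lborel"
    then have "(\<lambda>(y, z). f x y z) \<in> borel_measurable unit_square"
      by measurable
    from square.integral_product_swap[OF this]
    show "(\<integral>(y, z). f x z y \<partial>unit_square) = (\<integral>(y, z). f x y z \<partial>unit_square)"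
      by simp
  qed
  also have "\<dots> = (\<integral>(x, y, z). f x y z \<partial>unit_cube)"
    using bd by (subst cube.integral_fst'[symmetric])
      (auto intro!: cube.integrable_bounded[of _ B] simp: space_pair_measure)
  finally show ?thesis .
qed

lemma integral_cube_iterated:
  fixes f :: "real \<Rightarrow> real \<Rightarrow> real \<Rightarrow> real"
  assumes [measurable]: "(\<lambda>(x, y, z). f x y z) \<in> borel_measurable unit_cube"
    and bd: "\<And>x y z. x \<in> {0..1} \<Longrightarrow> y \<in> {0..1} \<Longrightarrow> z \<in> {0..1} \<Longrightarrow> \<bar>f x y z\<bar> \<le> B"
  shows "(\<integral>(x, y, z). f x y z \<partial>unit_cube) =
    (\<integral>x. \<integral>y. \<integral>z. f x y z \<partial>unit_lborel \<partial>unit_lborel \<partial>unit_lborel)"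
proof -
  have "(\<integral>(x, y, z). f x y z \<partial>unit_cube) = (\<integral>x. \<integral>(y, z). f x y z \<partial>unit_square \<partial>unit_lborel)"
    using bd by (subst cube.integral_fst'[symmetric])
      (auto intro!: cube.integrable_bounded[of _ B] simp: space_pair_measure)
  also have "\<dots> = (\<integral>x. \<integral>y. \<integral>z. f x y z \<partial>unit_lborel \<partial>unit_lborel \<partial>unit_lborel)"
  proof (rule Bochner_Integration.integral_cong[OF refl])
    fix x :: real assume x: "x \<in> space unit_lborel"
    then have "(\<lambda>(y, z). f x y z) \<in> borel_measurable unit_square"
      by measurable
    then show "(\<integral>(y, z). f x y z \<partial>unit_square) = (\<integral>y. \<integral>z. f x y z \<partial>unit_lborel \<partial>unit_lborel)"
      using bd x by (subst square.integral_fst'[symmetric])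
        (auto intro!: square.integrable_bounded[of _ B] simp: space_pair_measure)
  qed
  finally show ?thesis .
qed

text \<open>The cube is the product of the interval with the square, so the first two coordinates do
  not sit in one common factor. Integrating out z first leaves a function on the square, where the
  exchange of x and y is Fubini.\<close>

lemma integral_cube_swap12:
  fixes f :: "real \<Rightarrow> real \<Rightarrow> real \<Rightarrow> real"
  assumes [measurable]: "(\<lambda>(x, y, z). f x y z) \<in> borel_measurable unit_cube"
    and bd: "\<And>x y z. x \<in> {0..1} \<Longrightarrow> y \<in> {0..1} \<Longrightarrow> z \<in> {0..1} \<Longrightarrow> \<bar>f x y z\<bar> \<le> B"
  shows "(\<integral>(x, y, z). f y x z \<partial>unit_cube) = (\<integral>(x, y, z). f x y z \<partial>unit_cube)"
proof -
  have m: "(\<lambda>(x, y, z). f y x z) \<in> borel_measurable unit_cube"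
    using measurable_compose[OF _ assms(1), of "\<lambda>(x, y, z). (y, x, z)" unit_cube]
    by (simp add: case_prod_beta)
  have B: "\<bar>\<integral>z. f x y z \<partial>unit_lborel\<bar> \<le> B" if "x \<in> {0..1}" "y \<in> {0..1}" for x y
  proof -
    have m2: "(\<lambda>z. f x y z) \<in> borel_measurable unit_lborel"
    proof -
      have "(\<lambda>z. (x, y, z)) \<in> measurable unit_lborel unit_cube"
        using that by (intro measurable_Pair measurable_const measurable_ident) auto
      from measurable_compose[OF this assms(1)] show ?thesis by simp
    qed
    from bd[OF that] show ?thesis
      by (intro unit.abs_expectation_le[OF m2]) simp
  qed
  \<comment> \<open>Reassociating ((x, y), z) to (x, (y, z)) makes f measurable over the square
    times the interval, so that its integral over z is jointly measurable in x and y.\<close>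
  have "(\<lambda>q. (fst (fst q), snd (fst q), snd q)) \<in> measurable (unit_square \<Otimes>\<^sub>M unit_lborel) unit_cube"
    by measurable
  from measurable_compose[OF this assms(1)]
  have "(\<lambda>(p, z). f (fst p) (snd p) z) \<in> borel_measurable (unit_square \<Otimes>\<^sub>M unit_lborel)"
    by (simp add: case_prod_beta)
  then have "(\<lambda>(x, y). \<integral>z. f x y z \<partial>unit_lborel) \<in> borel_measurable unit_square"
    using unit.borel_measurable_lebesgue_integral by (simp add: case_prod_beta)
  from square.Fubini_integral[OF integrable_squareI[OF this B]]
  have "(\<integral>x. \<integral>y. (\<integral>z. f y x z \<partial>unit_lborel) \<partial>unit_lborel \<partial>unit_lborel)
      = (\<integral>x. \<integral>y. (\<integral>z. f x y z \<partial>unit_lborel) \<partial>unit_lborel \<partial>unit_lborel)" .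
  then show ?thesis
    using integral_cube_iterated[OF assms] integral_cube_iterated[OF m bd] by simp
qed

text \<open>Each of the three coordinates may hold the centre, since exchanging coordinates
  preserves the product measure: one exchange moves the centre to the second place, another one from
  there to the third.\<close>

lemma integral_cherry_permuted:
  assumes "graphon W"
  shows "(\<integral>(x, y, z). cherry W y x z \<partial>unit_cube) = t_ind_cherry W"
    and "(\<integral>(x, y, z). cherry W z x y \<partial>unit_cube) = t_ind_cherry W"
proof -
  note m = cherry_measurable[OF assms, measurable]
  have 1: "(\<lambda>(x, y, z). cherry W x y z) \<in> borel_measurable unit_cube"
    "(\<lambda>(x, y, z). cherry W y x z) \<in> borel_measurable unit_cube"
    by measurable
  show 2: "(\<integral>(x, y, z). cherry W y x z \<partial>unit_cube) = t_ind_cherry W"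
    unfolding t_ind_cherry_eq by (rule integral_cube_swap12[OF 1(1)]) (rule cherry_bounds(4)[OF assms])
  show "(\<integral>(x, y, z). cherry W z x y \<partial>unit_cube) = t_ind_cherry W"
    unfolding 2[symmetric] by (rule integral_cube_swap23[OF 1(2)]) (rule cherry_bounds(4)[OF assms])
qed

section \<open>Cluster graphons\<close>

text \<open>As an indicator of a union this has values 0 and 1 for every family of sets. For
  disjoint families it agrees with the series in \<open>cluster_graphon\<close>, since at most one
  term is then nonzero.\<close>

definition cluster_fun :: "(nat \<Rightarrow> real set) \<Rightarrow> real \<Rightarrow> real \<Rightarrow> real" where
  "cluster_fun A x y = indicator (\<Union>i. A i \<times> A i) (x, y)"

lemma cluster_fun_measurable:
  assumes [measurable]: "\<And>i. A i \<in> sets unit_lborel"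
  shows "(\<lambda>(x, y). cluster_fun A x y) \<in> borel_measurable unit_square"
proof -
  have "(\<Union>i. A i \<times> A i) \<in> sets unit_square"
    by measurable
  then have "(indicator (\<Union>i. A i \<times> A i) :: _ \<Rightarrow> real) \<in> borel_measurable unit_square"
    by (rule borel_measurable_indicator)
  moreover have "(\<lambda>(x, y). cluster_fun A x y) = indicator (\<Union>i. A i \<times> A i)"
    by (auto simp: cluster_fun_def)
  ultimately show ?thesis by simp
qed

lemma cluster_graphon_cluster_fun:
  assumes A: "\<And>i. A i \<in> sets unit_lborel" "disjoint_family A"
  shows "cluster_graphon (cluster_fun A)"
proof -
  have "cluster_fun A x y = (\<Sum>i. indicator (A i \<times> A i) (x, y))" for x y
  proof (cases "\<exists>i. (x, y) \<in> A i \<times> A i")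
    case True
    then obtain i where i: "(x, y) \<in> A i \<times> A i" by blast
    then have "(x, y) \<notin> A j \<times> A j" if "j \<noteq> i" for j
      using A(2) that unfolding disjoint_family_on_def by blast
    then have "(\<Sum>j. indicator (A j \<times> A j) (x, y)) = (\<Sum>j\<in>{i}. indicator (A j \<times> A j) (x, y) :: real)"
      by (intro suminf_finite) auto
    then show ?thesis
      using i by (auto simp: cluster_fun_def indicator_def)
  qed (auto simp: cluster_fun_def)
  moreover have "graphon (cluster_fun A)"
    unfolding graphon_def
    by (intro conjI cluster_fun_measurable A(1)) (auto simp: cluster_fun_def indicator_def)
  ultimately show ?thesis
    unfolding cluster_graphon_def using A by blast
qed

section \<open>Thresholded neighbourhoods and the cost of a pivot\<close>

definition thr :: "real \<Rightarrow> (real \<Rightarrow> real \<Rightarrow> real) \<Rightarrow> real \<Rightarrow> real \<Rightarrow> real" where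
  "thr \<theta> W x y = (if \<theta> \<le> W x y then 1 else 0)"

text \<open>The variable integrated out is the pivot, so this is the probability that a uniform
  pivot x reaches y.\<close>

definition thr_degree :: "real \<Rightarrow> (real \<Rightarrow> real \<Rightarrow> real) \<Rightarrow> real \<Rightarrow> real" where
  "thr_degree \<theta> W y = (\<integral>x. thr \<theta> W x y \<partial>unit_lborel)"

lemma thr_cases: "thr \<theta> W x y = 0 \<or> thr \<theta> W x y = 1"
  by (simp add: thr_def)

lemma thr_bounds: "0 \<le> thr \<theta> W x y" "thr \<theta> W x y \<le> 1"
  by (simp_all add: thr_def)

lemma thr_measurable:
  assumes "graphon W"
  shows "(\<lambda>(x, y). thr \<theta> W x y) \<in> borel_measurable unit_square"
proof -
  note graphon_measurable[OF assms, measurable]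
  show ?thesis
    unfolding thr_def by measurable
qed

lemma integrable_thr:
  assumes "graphon W" and "y \<in> {0..1}"
  shows "integrable unit_lborel (\<lambda>x. thr \<theta> W x y)"
proof -
  have "(\<lambda>x. thr \<theta> W x y) \<in> borel_measurable unit_lborel"
    using measurable_compose[OF _ thr_measurable[OF assms(1)], of "\<lambda>x. (x, y)" unit_lborel]
      assms(2) by simp
  then show ?thesis
    by (intro unit.integrable_bounded[of _ 1]) (simp_all add: thr_bounds)
qed

lemma thr_degree_measurable:
  assumes "graphon W"
  shows "thr_degree \<theta> W \<in> borel_measurable unit_lborel"
proof -
  note thr_measurable[OF assms, measurable]
  show ?thesis
    unfolding thr_degree_def by measurable
qed

lemma thr_degree_bounds:
  assumes "graphon W" "y \<in> {0..1}"
  shows "0 \<le> thr_degree \<theta> W y" "thr_degree \<theta> W y \<le> 1"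
  unfolding thr_degree_def using integrable_thr[OF assms]
  by (auto intro!: unit.integral_ge_const unit.integral_le_const AE_I2 simp: thr_bounds)

text \<open>The error at the pair (y, z) when x is the pivot. If both points are reached, the
  cluster puts 1 there and errs by \<open>1 - W y z\<close>; if exactly one is reached, the pair is
  separated for good and the error is \<open>W y z\<close>. A pair with neither point reached is
  left to later pivots and costs nothing yet.\<close>

definition pivot_cost :: "real \<Rightarrow> (real \<Rightarrow> real \<Rightarrow> real) \<Rightarrow> real \<Rightarrow> real \<Rightarrow> real \<Rightarrow> real" where
  "pivot_cost \<theta> W x y z =
     thr \<theta> W x y * thr \<theta> W x z * (1 - W y z) + thr \<theta> W x y * (1 - thr \<theta> W x z) * W y z
     + (1 - thr \<theta> W x y) * thr \<theta> W x z * W y z"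

lemma pivot_cost_measurable:
  assumes "graphon W" and [measurable]: "f \<in> measurable N unit_lborel"
    "g \<in> measurable N unit_lborel" "h \<in> measurable N unit_lborel"
  shows "(\<lambda>p. pivot_cost \<theta> W (f p) (g p) (h p)) \<in> borel_measurable N"
proof -
  note graphon_measurable[OF assms(1), measurable] thr_measurable[OF assms(1), measurable]
  show ?thesis
    unfolding pivot_cost_def by measurable
qed

lemma pivot_cost_bounds:
  assumes "graphon W" "y \<in> {0..1}" "z \<in> {0..1}"
  shows "0 \<le> pivot_cost \<theta> W x y z" "\<bar>pivot_cost \<theta> W x y z\<bar> \<le> 1"
  using graphon_bounds[OF assms] thr_cases[of \<theta> W x y] thr_cases[of \<theta> W x z]
  by (auto simp: pivot_cost_def)

text \<open>Every error is paid for by a cherry. If x reaches both points, the cherry is centred at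
  x and two of its factors are at least \<theta>. If x reaches only y, it is centred at y: the edge
  from y to x weighs at least \<theta>, and the missing edge from x to z weighs at least 1 -
  \<theta> \<ge> \<theta>. The case of z alone is symmetric.\<close>

lemma pivot_cost_le_cherries:
  assumes "graphon W" "x \<in> {0..1}" "y \<in> {0..1}" "z \<in> {0..1}" and \<theta>: "0 < \<theta>" "\<theta> \<le> 1/2"
  shows "\<theta>\<^sup>2 * pivot_cost \<theta> W x y z \<le> cherry W x y z + cherry W y x z + cherry W z x y"
proof -
  have key: "\<theta>\<^sup>2 * c \<le> a * b * c" if "\<theta> \<le> a" "\<theta> \<le> b" "0 \<le> c" for a b c :: real
    using that \<theta> unfolding power2_eq_square
    by (intro mult_right_mono mult_mono) auto
  have sym: "W y x = W x y" "W z x = W x z" "W z y = W y z"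
    using assms graphon_sym by blast+
  have w: "0 \<le> W y z" "0 \<le> 1 - W y z"
    using graphon_bounds[OF assms(1)] assms by auto
  have c: "0 \<le> cherry W x y z" "0 \<le> cherry W y x z" "0 \<le> cherry W z x y"
    using cherry_bounds[OF assms(1)] assms by auto
  consider "\<theta> \<le> W x y" "\<theta> \<le> W x z" | "\<theta> \<le> W x y" "\<theta> > W x z" | "\<theta> > W x y" "\<theta> \<le> W x z"
    | "\<theta> > W x y" "\<theta> > W x z"
    by linarith
  then show ?thesis
  proof cases
    case 1
    then have "\<theta>\<^sup>2 * pivot_cost \<theta> W x y z \<le> cherry W x y z"
      using key[of "W x y" "W x z" "1 - W y z"] w by (simp add: pivot_cost_def thr_def cherry_def)
    then show ?thesis using c by linarith
  next
    case 2
    then have "\<theta>\<^sup>2 * pivot_cost \<theta> W x y z \<le> cherry W y x z"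
      using key[of "W x y" "1 - W x z" "W y z"] w \<theta>
      by (simp add: pivot_cost_def thr_def cherry_def sym mult_ac)
    then show ?thesis using c by linarith
  next
    case 3
    then have "\<theta>\<^sup>2 * pivot_cost \<theta> W x y z \<le> cherry W z x y"
      using key[of "W x z" "1 - W x y" "W y z"] w \<theta>
      by (simp add: pivot_cost_def thr_def cherry_def sym mult_ac)
    then show ?thesis using c by linarith
  next
    case 4
    then have "pivot_cost \<theta> W x y z = 0"
      by (simp add: pivot_cost_def thr_def)
    then show ?thesis using c by simp
  qed
qed

text \<open>Integrating the pointwise bound, the three cherries with different centres each
  contribute one cherry density; this is the factor 3.\<close>

lemma integral_pivot_cost_le:
  assumes "graphon W" "0 < \<theta>" "\<theta> \<le> 1/2"
  shows "(\<integral>(x, y, z). pivot_cost \<theta> W x y z \<partial>unit_cube) \<le> 3 / \<theta>\<^sup>2 * t_ind_cherry W"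
proof -
  note cherry_measurable[OF assms(1), measurable] pivot_cost_measurable[OF assms(1), measurable]
  have m: "(\<lambda>(x, y, z). cherry W x y z) \<in> borel_measurable unit_cube"
    "(\<lambda>(x, y, z). cherry W y x z) \<in> borel_measurable unit_cube"
    "(\<lambda>(x, y, z). cherry W z x y) \<in> borel_measurable unit_cube"
    "(\<lambda>(x, y, z). pivot_cost \<theta> W x y z) \<in> borel_measurable unit_cube"
    by measurable
  have i: "integrable unit_cube (\<lambda>(x, y, z). cherry W x y z)"
    "integrable unit_cube (\<lambda>(x, y, z). cherry W y x z)"
    "integrable unit_cube (\<lambda>(x, y, z). cherry W z x y)"
    "integrable unit_cube (\<lambda>(x, y, z). pivot_cost \<theta> W x y z)"
    by (rule integrable_cubeI[OF m(1)] integrable_cubeI[OF m(2)] integrable_cubeI[OF m(3)]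
        integrable_cubeI[OF m(4)], (rule cherry_bounds(4)[OF assms(1)] pivot_cost_bounds(2)[OF assms(1)];
        assumption))+
  have "\<theta>\<^sup>2 * (\<integral>(x, y, z). pivot_cost \<theta> W x y z \<partial>unit_cube)
      = (\<integral>p. \<theta>\<^sup>2 * (case p of (x, y, z) \<Rightarrow> pivot_cost \<theta> W x y z) \<partial>unit_cube)"
    by simp
  also have "\<dots> \<le> (\<integral>p. (case p of (x, y, z) \<Rightarrow> cherry W x y z) + (case p of (x, y, z) \<Rightarrow> cherry W y x z)
        + (case p of (x, y, z) \<Rightarrow> cherry W z x y) \<partial>unit_cube)"
    using i pivot_cost_le_cherries[OF assms(1) _ _ _ assms(2,3)]
    by (intro integral_mono Bochner_Integration.integrable_add integrable_mult_right)
       (auto simp: space_pair_measure)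
  also have "\<dots> = 3 * t_ind_cherry W"
    using i integral_cherry_permuted[OF assms(1)] by (simp add: t_ind_cherry_eq)
  finally show ?thesis
    using assms(2) by (simp add: field_simps)
qed


section \<open>Points left over by the pivots\<close>

text \<open>Pointwise, W is at most its thresholded version plus \<theta>: it is at most 1 where the
  threshold is met and below \<theta> elsewhere. Symmetry of W allows z to take the place of the
  pivot, which produces the degree of y.\<close>

lemma integral_square_le_thr_degree:
  assumes "graphon W" and R [measurable]: "R \<in> sets unit_lborel" and "0 < \<theta>"
  shows "(\<integral>(y, z). indicator R y * indicator R z * W y z \<partial>unit_square)
    \<le> (\<integral>y. indicator R y * thr_degree \<theta> W y \<partial>unit_lborel) + \<theta>"
proof -
  note m [measurable] = graphon_measurable[OF assms(1)] thr_measurable[OF assms(1)]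
    thr_degree_measurable[OF assms(1)]
  note b = graphon_bounds[OF assms(1)]
  have m1: "(\<lambda>(y, z). indicator R y * indicator R z * W y z) \<in> borel_measurable unit_square"
    by measurable
  have b1: "\<bar>indicator R y * indicator R z * W y z\<bar> \<le> 1" if "y \<in> {0..1}" "z \<in> {0..1}" for y z
    using b[OF that] by (simp split: split_indicator)
  note i1 = integrable_squareI[OF m1 b1]
  have i2: "integrable unit_lborel (\<lambda>y. indicator R y * thr_degree \<theta> W y)"
    using thr_degree_bounds[OF assms(1)]
    by (intro unit.integrable_bounded[of _ 1]) (auto split: split_indicator)
  have "(\<integral>(y, z). indicator R y * indicator R z * W y z \<partial>unit_square)
      = (\<integral>y. \<integral>z. indicator R y * indicator R z * W y z \<partial>unit_lborel \<partial>unit_lborel)"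
    using square.integral_fst'[OF i1] by simp
  also have "\<dots> \<le> (\<integral>y. indicator R y * thr_degree \<theta> W y + \<theta> \<partial>unit_lborel)"
  proof (rule integral_mono)
    show "integrable unit_lborel (\<lambda>y. \<integral>z. indicator R y * indicator R z * W y z \<partial>unit_lborel)"
      using square.integrable_fst'[OF i1] by simp
    show "integrable unit_lborel (\<lambda>y. indicator R y * thr_degree \<theta> W y + \<theta>)"
      using i2 by simp
    fix y assume y: "y \<in> space unit_lborel"
    have mz: "(\<lambda>z. indicator R y * indicator R z * W y z) \<in> borel_measurable unit_lborel"
      using measurable_compose[OF measurable_Pair1'[OF y] m1] by simp
    have "(\<integral>z. indicator R y * indicator R z * W y z \<partial>unit_lborel)
      \<le> (\<integral>z. indicator R y * thr \<theta> W z y + \<theta> \<partial>unit_lborel)"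
    proof (rule integral_mono)
      show "integrable unit_lborel (\<lambda>z. indicator R y * indicator R z * W y z)"
        using b1 y by (intro unit.integrable_bounded[OF mz]) auto
      show "integrable unit_lborel (\<lambda>z. indicator R y * thr \<theta> W z y + \<theta>)"
        using integrable_thr[OF assms(1)] y by auto
      fix z assume z: "z \<in> space unit_lborel"
      then have "W y z = W z y"
        using y graphon_sym[OF assms(1)] by auto
      then show "indicator R y * indicator R z * W y z \<le> indicator R y * thr \<theta> W z y + \<theta>"
        using b[of z y] y z \<open>0 < \<theta>\<close> by (auto simp: thr_def split: split_indicator)
    qed
    also have "\<dots> = indicator R y * thr_degree \<theta> W y + \<theta>"
      using integrable_thr[OF assms(1)] y by (simp add: thr_degree_def)
    finally show "(\<integral>z. indicator R y * indicator R z * W y z \<partial>unit_lborel)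
      \<le> indicator R y * thr_degree \<theta> W y + \<theta>" .
  qed
  also have "\<dots> = (\<integral>y. indicator R y * thr_degree \<theta> W y \<partial>unit_lborel) + \<theta>"
    using i2 by simp
  finally show ?thesis .
qed

text \<open>
  The degree of \<open>y\<close> times the probability that none of \<open>k\<close> independent uniform pivots reaches \<open>y\<close>.
\<close>

definition uncovered :: "real \<Rightarrow> (real \<Rightarrow> real \<Rightarrow> real) \<Rightarrow> nat \<Rightarrow> real \<Rightarrow> real" where
  "uncovered \<theta> W k y = thr_degree \<theta> W y * (1 - thr_degree \<theta> W y) ^ k"

lemma uncovered_measurable:
  assumes "graphon W"
  shows "uncovered \<theta> W k \<in> borel_measurable unit_lborel"
proof -
  note thr_degree_measurable[OF assms, measurable]
  show ?thesis
    unfolding uncovered_def by measurable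
qed

text \<open>By Bernoulli, (1 - d)^k (1 + k d) \<le> (1 - d^2)^k \<le> 1, and d (k + 1) \<le> 1 + k d
  because d \<le> 1. The bound is uniform in d: points of large degree are soon reached, and points
  of small degree carry little weight.\<close>

lemma mult_power_compl_le:
  fixes d :: real
  assumes "0 \<le> d" "d \<le> 1"
  shows "d * (1 - d) ^ k \<le> 1 / (real k + 1)"
proof -
  have "(1 - d) ^ k * (1 + real k * d) \<le> (1 - d) ^ k * (1 + d) ^ k"
    using assms by (intro mult_left_mono Bernoulli_inequality) auto
  also have "\<dots> = (1 - d\<^sup>2) ^ k"
    by (simp add: power_mult_distrib[symmetric] power2_eq_square algebra_simps)
  also have "\<dots> \<le> 1"
    using assms by (intro power_le_one) (auto simp: power_le_one)
  finally have 1: "(1 - d) ^ k * (1 + real k * d) \<le> 1" .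
  have "d * (1 - d) ^ k * (real k + 1) = (1 - d) ^ k * (d + real k * d)"
    by (simp add: algebra_simps)
  also have "\<dots> \<le> (1 - d) ^ k * (1 + real k * d)"
    using assms by (intro mult_left_mono) auto
  finally show ?thesis
    using 1 by (simp add: pos_le_divide_eq)
qed

lemma uncovered_bounds:
  assumes "graphon W" "y \<in> {0..1}"
  shows "0 \<le> uncovered \<theta> W k y" "uncovered \<theta> W k y \<le> 1 / (real k + 1)"
    "\<bar>uncovered \<theta> W k y\<bar> \<le> 1"
proof -
  show 1: "0 \<le> uncovered \<theta> W k y" and 2: "uncovered \<theta> W k y \<le> 1 / (real k + 1)"
    unfolding uncovered_def using thr_degree_bounds[OF assms] by (auto intro: mult_power_compl_le)
  have "1 / (real k + 1) \<le> 1" by simp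
  with 1 2 show "\<bar>uncovered \<theta> W k y\<bar> \<le> 1" by linarith
qed

text \<open>By Fubini the average over x can be taken first at fixed y. The chance that x misses y
  is 1 minus the degree of y, which raises the exponent in \<open>uncovered\<close> by one.\<close>

lemma expectation_uncovered:
  assumes "graphon W" and R [measurable]: "R \<in> sets unit_lborel"
  shows "integrable unit_lborel
      (\<lambda>x. \<integral>y. indicator R y * (1 - thr \<theta> W x y) * uncovered \<theta> W k y \<partial>unit_lborel)" (is ?I)
    and "(\<integral>x. \<integral>y. indicator R y * (1 - thr \<theta> W x y) * uncovered \<theta> W k y \<partial>unit_lborel \<partial>unit_lborel)
      = (\<integral>y. indicator R y * uncovered \<theta> W (Suc k) y \<partial>unit_lborel)" (is ?E)
proof -
  note thr_measurable[OF assms(1), measurable] uncovered_measurable[OF assms(1), measurable]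
  let ?f = "\<lambda>x y. indicator R y * (1 - thr \<theta> W x y) * uncovered \<theta> W k y"
  have m: "(\<lambda>(x, y). ?f x y) \<in> borel_measurable unit_square"
    by measurable
  have b: "\<bar>?f x y\<bar> \<le> 1" if "x \<in> {0..1}" "y \<in> {0..1}" for x y
    using thr_cases[of \<theta> W x y] uncovered_bounds(3)[OF assms(1) that(2), of \<theta> k]
    by (auto split: split_indicator)
  note i = integrable_squareI[OF m b]
  show ?I
    using square.integrable_fst'[OF i] by simp
  have "(\<integral>x. \<integral>y. ?f x y \<partial>unit_lborel \<partial>unit_lborel) = (\<integral>y. \<integral>x. ?f x y \<partial>unit_lborel \<partial>unit_lborel)"
    by (rule square.Fubini_integral[OF i, symmetric])
  also have "\<dots> = (\<integral>y. indicator R y * uncovered \<theta> W (Suc k) y \<partial>unit_lborel)"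
  proof (rule Bochner_Integration.integral_cong[OF refl])
    fix y assume "y \<in> space unit_lborel"
    then have "(\<integral>x. 1 - thr \<theta> W x y \<partial>unit_lborel) = 1 - thr_degree \<theta> W y"
      using integrable_thr[OF assms(1)] by (simp add: thr_degree_def)
    then show "(\<integral>x. ?f x y \<partial>unit_lborel) = indicator R y * uncovered \<theta> W (Suc k) y"
      by (simp add: uncovered_def mult_ac)
  qed
  finally show ?E .
qed

section \<open>Clustering by successive pivots\<close>

text \<open>Induction on the number k of pivots, derandomised by conditional expectations. R is the
  set of points still unassigned, hence it varies in the induction. The clusters are kept inside R
  so that those found later are disjoint from the one cut off first.\<close>

lemma pivot_clustering:
  assumes W: "graphon W" and \<theta>: "0 < \<theta>" "\<theta> \<le> 1/2"
    and "R \<in> sets unit_lborel"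
  shows "\<exists>A. (\<forall>i. A i \<in> sets unit_lborel \<and> A i \<subseteq> R) \<and> disjoint_family A \<and>
    (\<integral>(y, z). indicator R y * indicator R z * \<bar>W y z - cluster_fun A y z\<bar> \<partial>unit_square)
      \<le> real k * (3 / \<theta>\<^sup>2 * t_ind_cherry W)
        + (\<integral>y. indicator R y * uncovered \<theta> W k y \<partial>unit_lborel) + \<theta>"
  using assms(4)
proof (induction k arbitrary: R)
  case 0
  \<comment> \<open>With no pivots there are no clusters, and the error is the whole edge weight
    inside R. At k = 0 the power in \<open>uncovered\<close> is 1, so the bound is the one by
    degrees.\<close>
  have "(\<integral>(y, z). indicator R y * indicator R z * \<bar>W y z - cluster_fun (\<lambda>_. {}) y z\<bar> \<partial>unit_square)
    = (\<integral>(y, z). indicator R y * indicator R z * W y z \<partial>unit_square)"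
    using graphon_bounds[OF W]
    by (intro Bochner_Integration.integral_cong) (auto simp: cluster_fun_def space_pair_measure)
  then show ?case
    using integral_square_le_thr_degree[OF W 0 \<theta>(1)]
    by (intro exI[of _ "\<lambda>_. {}"]) (simp add: uncovered_def disjoint_family_on_def)
next
  case (Suc k)
  note R [measurable] = Suc.prems
  note m [measurable] = graphon_measurable[OF W] thr_measurable[OF W] uncovered_measurable[OF W]
  have mp: "(\<lambda>(x, y, z). pivot_cost \<theta> W x y z) \<in> borel_measurable unit_cube"
    using pivot_cost_measurable[OF W, of fst unit_cube "\<lambda>p. fst (snd p)" "\<lambda>p. snd (snd p)" \<theta>]
    by (simp add: case_prod_beta)
  note ip = integrable_cubeI[OF mp pivot_cost_bounds(2)[OF W]]
  \<comment> \<open>The part of the error bound that depends on the first pivot x: its own cost,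
    plus the expected leftover after k more pivots on the points that x misses. Its mean over x is
    the bound to be reached, so some x does no worse than the mean.\<close>
  define G where "G x = (\<integral>(y, z). pivot_cost \<theta> W x y z \<partial>unit_square)
      + (\<integral>y. indicator R y * (1 - thr \<theta> W x y) * uncovered \<theta> W k y \<partial>unit_lborel)" for x
  have ip1: "integrable unit_lborel (\<lambda>x. \<integral>(y, z). pivot_cost \<theta> W x y z \<partial>unit_square)"
    using cube.integrable_fst'[OF ip] by simp
  have "(\<integral>x. G x \<partial>unit_lborel) = (\<integral>(x, y, z). pivot_cost \<theta> W x y z \<partial>unit_cube)
      + (\<integral>y. indicator R y * uncovered \<theta> W (Suc k) y \<partial>unit_lborel)"
    unfolding G_def using cube.integral_fst'[OF ip] ip1 expectation_uncovered[OF W R, of \<theta> k]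
    by simp
  moreover have "integrable unit_lborel G"
    unfolding G_def using ip1 expectation_uncovered(1)[OF W R] by (rule Bochner_Integration.integrable_add)
  ultimately obtain x where x: "x \<in> {0..1}"
    and "G x \<le> (\<integral>(x, y, z). pivot_cost \<theta> W x y z \<partial>unit_cube)
      + (\<integral>y. indicator R y * uncovered \<theta> W (Suc k) y \<partial>unit_lborel)"
    by (metis unit.exists_le_expectation space_unit_lborel)
  then have Gx: "G x \<le> 3 / \<theta>\<^sup>2 * t_ind_cherry W
      + (\<integral>y. indicator R y * uncovered \<theta> W (Suc k) y \<partial>unit_lborel)"
    using integral_pivot_cost_le[OF W \<theta>] by linarith
  have mx: "thr \<theta> W x \<in> borel_measurable unit_lborel"
    using measurable_compose[OF measurable_Pair1'[of x] m(2)] x by simp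
  define N where "N = R \<inter> {y \<in> space unit_lborel. thr \<theta> W x y = 1}"
  have N [measurable]: "N \<in> sets unit_lborel" and R1 [measurable]: "R - N \<in> sets unit_lborel"
    using mx unfolding N_def by measurable
  from Suc.IH[OF R1] obtain A where A: "\<And>i. A i \<in> sets unit_lborel" "\<And>i. A i \<subseteq> R - N" "disjoint_family A"
    and IH: "(\<integral>(y, z). indicator (R - N) y * indicator (R - N) z * \<bar>W y z - cluster_fun A y z\<bar> \<partial>unit_square)
      \<le> real k * (3 / \<theta>\<^sup>2 * t_ind_cherry W)
        + (\<integral>y. indicator (R - N) y * uncovered \<theta> W k y \<partial>unit_lborel) + \<theta>"
    by blast
  \<comment> \<open>The new cluster gets index 0 and the later ones move up by one. Disjointness
    holds because the sets A i lie in R - N.\<close>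
  define B where "B = case_nat N A"
  have B: "B i \<in> sets unit_lborel" "B i \<subseteq> R" for i
    using A(1,2) N by (auto simp: B_def N_def split: nat.split)
  have "disjoint_family B"
    using A(2,3) unfolding B_def disjoint_family_on_def by (auto split: nat.split)
  moreover have "(\<integral>(y, z). indicator R y * indicator R z * \<bar>W y z - cluster_fun B y z\<bar> \<partial>unit_square)
      \<le> (\<integral>(y, z). pivot_cost \<theta> W x y z \<partial>unit_square)
        + (\<integral>(y, z). indicator (R - N) y * indicator (R - N) z * \<bar>W y z - cluster_fun A y z\<bar> \<partial>unit_square)"
  proof -
    note mc [measurable] = cluster_fun_measurable[OF A(1)] cluster_fun_measurable[OF B(1)]
    have cb: "0 \<le> cluster_fun C y z" "cluster_fun C y z \<le> 1" for C y z
      by (auto simp: cluster_fun_def indicator_def)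
    have bd: "\<bar>W y z - cluster_fun C y z\<bar> \<le> 1" if "y \<in> {0..1}" "z \<in> {0..1}" for C y z
      using graphon_bounds[OF W that] cb[of C y z] by linarith
    have "(\<lambda>(y, z). indicator R y * indicator R z * \<bar>W y z - cluster_fun B y z\<bar>) \<in> borel_measurable unit_square"
      by measurable
    then have i1: "integrable unit_square (\<lambda>(y, z). indicator R y * indicator R z * \<bar>W y z - cluster_fun B y z\<bar>)"
      using bd by (rule_tac integrable_squareI[of _ 1]) (auto split: split_indicator)
    have "(\<lambda>(y, z). indicator (R - N) y * indicator (R - N) z * \<bar>W y z - cluster_fun A y z\<bar>) \<in> borel_measurable unit_square"
      by measurable
    then have i2: "integrable unit_square (\<lambda>(y, z). indicator (R - N) y * indicator (R - N) z * \<bar>W y z - cluster_fun A y z\<bar>)"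
      using bd by (rule_tac integrable_squareI[of _ 1]) (auto split: split_indicator)
    have "(\<lambda>(y, z). pivot_cost \<theta> W x y z) \<in> borel_measurable unit_square"
      using measurable_compose[OF measurable_Pair1'[of x] mp] x by simp
    then have i3: "integrable unit_square (\<lambda>(y, z). pivot_cost \<theta> W x y z)"
      by (rule integrable_squareI) (rule pivot_cost_bounds(2)[OF W])
    have "(\<integral>p. (case p of (y, z) \<Rightarrow> indicator R y * indicator R z * \<bar>W y z - cluster_fun B y z\<bar>) \<partial>unit_square)
      \<le> (\<integral>p. (case p of (y, z) \<Rightarrow> pivot_cost \<theta> W x y z)
        + (case p of (y, z) \<Rightarrow> indicator (R - N) y * indicator (R - N) z * \<bar>W y z - cluster_fun A y z\<bar>) \<partial>unit_square)"
    proof (rule integral_mono[OF i1 Bochner_Integration.integrable_add[OF i3 i2]])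
      fix p assume "p \<in> space unit_square"
      then obtain y z where p: "p = (y, z)" and y: "y \<in> {0..1}" and z: "z \<in> {0..1}"
        by (auto simp: space_pair_measure)
      have "indicator R y * indicator R z * \<bar>W y z - cluster_fun B y z\<bar>
        \<le> pivot_cost \<theta> W x y z + indicator (R - N) y * indicator (R - N) z * \<bar>W y z - cluster_fun A y z\<bar>"
      \<comment> \<open>Outside R x R the left side is 0. Inside, being reached by x means lying in
        N. If y or z lies in N, then no A i contains both, so the error of B is exactly the pivot
        cost; if neither does, B and A agree at the pair and the second summand takes over.\<close>
      proof (cases "y \<in> R \<and> z \<in> R")
        case True
        have w: "0 \<le> W y z" "W y z \<le> 1"
          using graphon_bounds[OF W y z] .
        have ty: "thr \<theta> W x y = indicator N y" and tz: "thr \<theta> W x z = indicator N z"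
          using True y z thr_cases[of \<theta> W x y] thr_cases[of \<theta> W x z] by (auto simp: N_def)
        have cB: "cluster_fun B y z = (if y \<in> N \<and> z \<in> N then 1 else cluster_fun A y z)"
        proof -
          have "(\<exists>i. y \<in> B i \<and> z \<in> B i) \<longleftrightarrow> (y \<in> N \<and> z \<in> N) \<or> (\<exists>i. y \<in> A i \<and> z \<in> A i)"
            unfolding B_def by (metis nat.case nat.exhaust)
          then show ?thesis
            by (auto simp: cluster_fun_def indicator_def)
        qed
        have cA: "y \<in> N \<or> z \<in> N \<Longrightarrow> cluster_fun A y z = 0"
          using A(2) by (force simp: cluster_fun_def indicator_def)
        show ?thesis
          using w True cA by (auto simp: pivot_cost_def ty tz cB indicator_def)
      qed (use pivot_cost_bounds(1)[OF W y z] in \<open>auto simp: indicator_def\<close>)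
      then show "(case p of (y, z) \<Rightarrow> indicator R y * indicator R z * \<bar>W y z - cluster_fun B y z\<bar>)
        \<le> (case p of (y, z) \<Rightarrow> pivot_cost \<theta> W x y z)
          + (case p of (y, z) \<Rightarrow> indicator (R - N) y * indicator (R - N) z * \<bar>W y z - cluster_fun A y z\<bar>)"
        by (simp add: p)
    qed
    also have "\<dots> = (\<integral>(y, z). pivot_cost \<theta> W x y z \<partial>unit_square)
        + (\<integral>(y, z). indicator (R - N) y * indicator (R - N) z * \<bar>W y z - cluster_fun A y z\<bar> \<partial>unit_square)"
      by (rule Bochner_Integration.integral_add[OF i3 i2])
    finally show ?thesis .
  qed
  \<comment> \<open>This turns the leftover term of the induction hypothesis into the second summand
    of \<open>G x\<close>.\<close>
  moreover have "(\<integral>y. indicator (R - N) y * uncovered \<theta> W k y \<partial>unit_lborel)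
      = (\<integral>y. indicator R y * (1 - thr \<theta> W x y) * uncovered \<theta> W k y \<partial>unit_lborel)"
  proof (rule Bochner_Integration.integral_cong[OF refl])
    fix y assume "y \<in> space unit_lborel"
    then show "indicator (R - N) y * uncovered \<theta> W k y = indicator R y * (1 - thr \<theta> W x y) * uncovered \<theta> W k y"
      using thr_cases[of \<theta> W x y] by (auto simp: N_def indicator_def)
  qed
  ultimately have "(\<integral>(y, z). indicator R y * indicator R z * \<bar>W y z - cluster_fun B y z\<bar> \<partial>unit_square)
      \<le> real (Suc k) * (3 / \<theta>\<^sup>2 * t_ind_cherry W)
        + (\<integral>y. indicator R y * uncovered \<theta> W (Suc k) y \<partial>unit_lborel) + \<theta>"
    using Gx IH unfolding G_def of_nat_Suc distrib_right mult_1 by linarith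
  then show ?case
    using B \<open>disjoint_family B\<close> by blast
qed

definition L1_dist :: "(real \<Rightarrow> real \<Rightarrow> real) \<Rightarrow> (real \<Rightarrow> real \<Rightarrow> real) \<Rightarrow> real" where
  "L1_dist U W = (\<integral>(x, y). \<bar>U x y - W x y\<bar> \<partial>unit_square)"

text \<open>The error \<eta> is split into three equal parts: \<theta> bounds the light edges, k
  makes the leftover 1 / (k + 1) small, and only then is \<epsilon> chosen, depending on both, so
  that k pivots are cheap.\<close>

lemma t_ind_cherry_small_imp_near_cluster:
  assumes "0 < \<eta>"
  obtains \<epsilon> where "0 < \<epsilon>"
    "\<And>W. graphon W \<Longrightarrow> t_ind_cherry W \<le> \<epsilon> \<Longrightarrow>
      \<exists>A. (\<forall>i. A i \<in> sets unit_lborel) \<and> disjoint_family A \<and> L1_dist W (cluster_fun A) \<le> \<eta>"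
proof -
  define \<theta> where "\<theta> = min (1/2) (\<eta> / 3)"
  have \<theta>: "0 < \<theta>" "\<theta> \<le> 1/2" "\<theta> \<le> \<eta> / 3"
    using assms by (auto simp: \<theta>_def)
  obtain k :: nat where k: "3 / \<eta> \<le> real k"
    using real_arch_simple by blast
  then have "3 / \<eta> \<le> real k + 1" by linarith
  then have k': "1 / (real k + 1) \<le> \<eta> / 3"
    using assms by (simp add: field_simps)
  define c where "c = 3 / \<theta>\<^sup>2"
  have c: "0 < c" using \<theta> by (simp add: c_def)
  show thesis
  \<comment> \<open>The value solves c (k + 1) \<epsilon> = \<eta> / 3, where c times the cherry
    density bounds the cost of one pivot.\<close>
  proof (rule that[of "\<eta> / (3 * c * (real k + 1))"])
    show "0 < \<eta> / (3 * c * (real k + 1))"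
      using assms c by simp
    fix W assume W: "graphon W" and le: "t_ind_cherry W \<le> \<eta> / (3 * c * (real k + 1))"
    from pivot_clustering[OF W \<theta>(1,2), of "{0..1}" k]
    obtain A where A: "\<And>i. A i \<in> sets unit_lborel" "disjoint_family A"
      and bd: "(\<integral>(y, z). indicator {0..1} y * indicator {0..1} z * \<bar>W y z - cluster_fun A y z\<bar> \<partial>unit_square)
      \<le> real k * (c * t_ind_cherry W)
        + (\<integral>y. indicator {0..1} y * uncovered \<theta> W k y \<partial>unit_lborel) + \<theta>"
      using sets.top[of unit_lborel] unfolding c_def by auto
    have "L1_dist W (cluster_fun A)
      = (\<integral>(y, z). indicator {0..1} y * indicator {0..1} z * \<bar>W y z - cluster_fun A y z\<bar> \<partial>unit_square)"
      unfolding L1_dist_def by (intro Bochner_Integration.integral_cong) (auto simp: space_pair_measure)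
    moreover have "real k * (c * t_ind_cherry W) \<le> \<eta> / 3"
    proof -
      have "real k * (c * t_ind_cherry W) \<le> real k * (c * (\<eta> / (3 * c * (real k + 1))))"
        using le c by (intro mult_left_mono) auto
      also have "\<dots> = \<eta> / 3 * (real k / (real k + 1))"
        using c by simp
      also have "\<dots> \<le> \<eta> / 3 * 1"
        using assms by (intro mult_left_mono) auto
      finally show ?thesis by simp
    qed
    moreover have "(\<integral>y. indicator {0..1} y * uncovered \<theta> W k y \<partial>unit_lborel) \<le> \<eta> / 3"
    proof -
      note uncovered_measurable[OF W, measurable]
      have [measurable]: "{0..1::real} \<in> sets unit_lborel"
        using sets.top[of unit_lborel] by simp
      have "(\<integral>y. indicator {0..1} y * uncovered \<theta> W k y \<partial>unit_lborel) \<le> 1 / (real k + 1)"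
      proof (rule unit.integral_le_const)
        show "integrable unit_lborel (\<lambda>y. indicator {0..1} y * uncovered \<theta> W k y)"
          using uncovered_bounds(3)[OF W] by (intro unit.integrable_bounded[of _ 1]) auto
        show "AE y in unit_lborel. indicator {0..1} y * uncovered \<theta> W k y \<le> 1 / (real k + 1)"
          using uncovered_bounds(2)[OF W] by (intro AE_I2) auto
      qed
      then show ?thesis using k' by linarith
    qed
    ultimately have "L1_dist W (cluster_fun A) \<le> \<eta>"
      using bd \<theta>(3) by linarith
    then show "\<exists>A. (\<forall>i. A i \<in> sets unit_lborel) \<and> disjoint_family A \<and> L1_dist W (cluster_fun A) \<le> \<eta>"
      using A by blast
  qed
qed

section \<open>Entropy near 0-1-valued graphons\<close>

definition neg_entropy :: "real \<Rightarrow> real" where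
  "neg_entropy w = w * ln w + (1 - w) * ln (1 - w)"

lemma graphon_entropy_eq: "graphon_entropy W = (\<integral>(x, y). neg_entropy (W x y) \<partial>unit_square)"
  by (simp add: graphon_entropy_def neg_entropy_def)

text \<open>From ln a \<le> a - 1 one gets v ln (t / v) \<le> t - v, also at v = 0. Applied to (w,
  s) and to (1 - w, 1 - s), the right sides add up to 0.\<close>

lemma neg_entropy_gibbs:
  assumes "0 \<le> w" "w \<le> 1" "0 < s" "s < 1"
  shows "w * ln s + (1 - w) * ln (1 - s) \<le> neg_entropy w"
proof -
  have *: "v * ln t - v * ln v \<le> t - v" if "0 \<le> v" "0 < t" for v t :: real
  proof (cases "v = 0")
    case False
    then have "v * ln (t / v) \<le> v * (t / v - 1)"
      using that by (intro mult_left_mono ln_le_minus_one) auto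
    then show ?thesis
      using that False by (simp add: ln_div algebra_simps)
  qed (use that in simp)
  show ?thesis
    using *[of w s] *[of "1 - w" "1 - s"] assms by (simp add: neg_entropy_def)
qed

lemma neg_entropy_le_0: "0 \<le> w \<Longrightarrow> w \<le> 1 \<Longrightarrow> neg_entropy w \<le> 0"
  unfolding neg_entropy_def
  by (cases "w = 0"; cases "w = 1")
     (auto intro!: add_nonpos_nonpos mult_nonneg_nonpos simp: ln_le_zero_iff)

lemma neg_entropy_ge: "0 \<le> w \<Longrightarrow> w \<le> 1 \<Longrightarrow> - ln 2 \<le> neg_entropy w"
  using neg_entropy_gibbs[of w "1/2"] by (simp add: ln_div algebra_simps)

text \<open>Gibbs with a fixed reference s bounds the entropy integrand below by an affine function
  of the distance to u, which can be integrated to an \<open>L1_dist\<close> bound. The constant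
  term, close to 0 for small s, pays for the infinite slope of the entropy at 0 and 1. The case u =
  1 follows by the symmetry between w and 1 - w.\<close>

lemma neg_entropy_near_01:
  assumes "0 \<le> w" "w \<le> 1" "0 < s" "s < 1/2" "u = 0 \<or> u = 1"
  shows "ln (1 - s) - \<bar>w - u\<bar> * (ln (1 - s) - ln s) \<le> neg_entropy w"
  using assms(5)
proof
  assume "u = 0"
  then show ?thesis
    using neg_entropy_gibbs[of w s] assms by (simp add: algebra_simps)
next
  assume u: "u = 1"
  have "neg_entropy (1 - w) = neg_entropy w"
    by (simp add: neg_entropy_def)
  then show ?thesis
    using neg_entropy_gibbs[of "1 - w" s] assms u by (simp add: algebra_simps)
qed

lemma integrable_neg_entropy:
  assumes "graphon W"
  shows "integrable unit_square (\<lambda>(x, y). neg_entropy (W x y))"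
proof -
  note graphon_measurable[OF assms, measurable]
  have "(\<lambda>(x, y). neg_entropy (W x y)) \<in> borel_measurable unit_square"
    unfolding neg_entropy_def by measurable
  then show ?thesis
  proof (rule integrable_squareI)
    fix x y :: real assume "x \<in> {0..1}" "y \<in> {0..1}"
    from graphon_bounds[OF assms this] neg_entropy_le_0 neg_entropy_ge
    show "\<bar>neg_entropy (W x y)\<bar> \<le> ln 2"
      by (smt (verit))
  qed
qed

lemma graphon_entropy_bounds:
  assumes "graphon W"
  shows "graphon_entropy W \<le> 0" "- ln 2 \<le> graphon_entropy W"
  unfolding graphon_entropy_eq using integrable_neg_entropy[OF assms] graphon_bounds[OF assms]
  by (auto intro!: square.integral_le_const square.integral_ge_const AE_I2 neg_entropy_le_0 neg_entropy_ge
      simp: space_pair_measure)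

lemma integrable_abs_diff:
  assumes "graphon U" "graphon W"
  shows "integrable unit_square (\<lambda>(x, y). \<bar>U x y - W x y\<bar>)"
proof -
  note graphon_measurable[OF assms(1), measurable] graphon_measurable[OF assms(2), measurable]
  have "(\<lambda>(x, y). \<bar>U x y - W x y\<bar>) \<in> borel_measurable unit_square"
    by measurable
  then show ?thesis
  proof (rule integrable_squareI)
    fix x y :: real assume "x \<in> {0..1}" "y \<in> {0..1}"
    with graphon_bounds[OF assms(1) this] graphon_bounds[OF assms(2) this]
    show "\<bar>\<bar>U x y - W x y\<bar>\<bar> \<le> 1" by linarith
  qed
qed

lemma graphon_entropy_near_01:
  assumes "graphon W" "graphon U" "\<And>x y. U x y = 0 \<or> U x y = 1" "0 < s" "s < 1/2"
  shows "ln (1 - s) - L1_dist W U * (ln (1 - s) - ln s) \<le> graphon_entropy W"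
proof -
  note i = integrable_abs_diff[OF assms(1,2)]
  have "ln (1 - s) - L1_dist W U * (ln (1 - s) - ln s)
      = (\<integral>p. ln (1 - s) - (case p of (x, y) \<Rightarrow> \<bar>W x y - U x y\<bar>) * (ln (1 - s) - ln s) \<partial>unit_square)"
    using i square.prob_space by (simp add: L1_dist_def)
  also have "\<dots> \<le> (\<integral>p. (case p of (x, y) \<Rightarrow> neg_entropy (W x y)) \<partial>unit_square)"
    using i integrable_neg_entropy[OF assms(1)] graphon_bounds[OF assms(1)]
      neg_entropy_near_01[OF _ _ assms(4,5,3)]
    by (intro integral_mono) (auto simp: space_pair_measure)
  finally show ?thesis
    by (simp add: graphon_entropy_eq)
qed

lemma t_ind_cherry_small_imp_entropy_small:
  assumes "0 < \<delta>"
  obtains \<epsilon> where "0 < \<epsilon>" "\<And>W. graphon W \<Longrightarrow> t_ind_cherry W \<le> \<epsilon> \<Longrightarrow> - \<delta> \<le> graphon_entropy W"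
proof -
  \<comment> \<open>The second entry of the minimum makes ln (1 - s) at least - \<delta> / 2; the
    first keeps s below 1/2, so that the slope K is positive. Distance \<delta> / (2 K) to a cluster
    graphon then costs the other \<delta> / 2.\<close>
  define s where "s = min (1/4) (1 - exp (- \<delta> / 2))"
  have s: "0 < s" "s < 1/2" "exp (- \<delta> / 2) \<le> 1 - s"
  proof -
    have "s \<le> 1/4" "s \<le> 1 - exp (- \<delta> / 2)"
      unfolding s_def by (rule min.cobounded1, rule min.cobounded2)
    then show "s < 1/2" "exp (- \<delta> / 2) \<le> 1 - s"
      by linarith+
    show "0 < s"
      using assms by (simp add: s_def)
  qed
  then have "- \<delta> / 2 \<le> ln (1 - s)"
    by (subst ln_ge_iff) auto
  define K where "K = ln (1 - s) - ln s"
  have K: "0 < K" using s by (simp add: K_def)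
  obtain \<epsilon> where \<epsilon>: "0 < \<epsilon>" "\<And>W. graphon W \<Longrightarrow> t_ind_cherry W \<le> \<epsilon> \<Longrightarrow>
      \<exists>A. (\<forall>i. A i \<in> sets unit_lborel) \<and> disjoint_family A \<and> L1_dist W (cluster_fun A) \<le> \<delta> / (2 * K)"
    using t_ind_cherry_small_imp_near_cluster[of "\<delta> / (2 * K)"] assms K by auto
  show thesis
  proof (rule that[OF \<epsilon>(1)])
    fix W assume W: "graphon W" "t_ind_cherry W \<le> \<epsilon>"
    from \<epsilon>(2)[OF this] obtain A where A: "\<And>i. A i \<in> sets unit_lborel" "disjoint_family A"
      and L: "L1_dist W (cluster_fun A) \<le> \<delta> / (2 * K)"
      by blast
    have "graphon (cluster_fun A)"
      using cluster_graphon_cluster_fun[OF A] by (simp add: cluster_graphon_def)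
    moreover have "cluster_fun A x y = 0 \<or> cluster_fun A x y = 1" for x y
      by (auto simp: cluster_fun_def indicator_def)
    ultimately have "ln (1 - s) - L1_dist W (cluster_fun A) * K \<le> graphon_entropy W"
      unfolding K_def using s by (intro graphon_entropy_near_01[OF W(1)]) auto
    moreover have "L1_dist W (cluster_fun A) * K \<le> \<delta> / 2"
      using L K by (simp add: field_simps)
    ultimately show "- \<delta> \<le> graphon_entropy W"
      using \<open>- \<delta> / 2 \<le> ln (1 - s)\<close> by linarith
  qed
qed

section \<open>Edge and cherry densities\<close>

lemma t_edge_bounds:
  assumes "graphon W"
  shows "0 \<le> t_edge W" "t_edge W \<le> 1" "integrable unit_square (\<lambda>(x, y). W x y)"
proof -
  show i: "integrable unit_square (\<lambda>(x, y). W x y)"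
    by (rule integrable_squareI[OF graphon_measurable[OF assms], of 1]) (use graphon_bounds[OF assms] in auto)
  show "0 \<le> t_edge W" "t_edge W \<le> 1"
    unfolding t_edge_def using i graphon_bounds[OF assms]
    by (auto intro!: square.integral_le_const square.integral_ge_const AE_I2 simp: space_pair_measure)
qed

text \<open>A cherry contains an edge and a non-edge, and its weight is at most that of either.
  Hence the cherry density vanishes whenever the edge density is 0 or 1, which applies to any
  representative of a constant class.\<close>

lemma t_ind_cherry_bounds:
  assumes "graphon W"
  shows "0 \<le> t_ind_cherry W" "t_ind_cherry W \<le> t_edge W" "t_ind_cherry W \<le> 1 - t_edge W"
proof -
  note cherry_measurable[OF assms, measurable] graphon_measurable[OF assms, measurable]
  have m: "(\<lambda>(x, y, z). cherry W x y z) \<in> borel_measurable unit_cube"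
    "(\<lambda>(x, y, z). W x y) \<in> borel_measurable unit_cube"
    "(\<lambda>(x, y, z). 1 - W y z) \<in> borel_measurable unit_cube"
    by measurable
  note i = integrable_cubeI[OF m(1) cherry_bounds(4)[OF assms]]
  have b: "\<bar>W x y\<bar> \<le> 1" "\<bar>1 - W x y\<bar> \<le> 1" if "x \<in> {0..1}" "y \<in> {0..1}" for x y
    using graphon_bounds[OF assms that] by auto
  note c = cherry_bounds[OF assms]
  show "0 \<le> t_ind_cherry W"
    unfolding t_ind_cherry_eq using i c
    by (intro cube.integral_ge_const AE_I2) (auto simp: space_pair_measure)
  have "t_ind_cherry W \<le> (\<integral>(x, y, z). W x y \<partial>unit_cube)"
    unfolding t_ind_cherry_eq using i integrable_cubeI[OF m(2) b(1)] c
    by (intro integral_mono) (auto simp: space_pair_measure)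
  also have "\<dots> = (\<integral>x. \<integral>y. \<integral>z. W x y \<partial>unit_lborel \<partial>unit_lborel \<partial>unit_lborel)"
    by (rule integral_cube_iterated[OF m(2) b(1)])
  also have "\<dots> = t_edge W"
    using square.integral_fst'[OF t_edge_bounds(3)[OF assms]] by (simp add: t_edge_def)
  finally show "t_ind_cherry W \<le> t_edge W" .
  have "t_ind_cherry W \<le> (\<integral>(x, y, z). 1 - W y z \<partial>unit_cube)"
    unfolding t_ind_cherry_eq using i integrable_cubeI[OF m(3) b(2)] c
    by (intro integral_mono) (auto simp: space_pair_measure)
  also have "\<dots> = (\<integral>x. \<integral>p. (1 - (case p of (y, z) \<Rightarrow> W y z)) \<partial>unit_square \<partial>unit_lborel)"
    using cube.integral_fst'[OF integrable_cubeI[OF m(3) b(2)]] by (simp add: case_prod_beta)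
  also have "\<dots> = 1 - t_edge W"
    using t_edge_bounds(3)[OF assms] square.prob_space by (simp add: t_edge_def)
  finally show "t_ind_cherry W \<le> 1 - t_edge W" .
qed

section \<open>Cut norm and cut distance\<close>

lemma mp_bijections_measurable: "\<phi> \<in> mp_bijections \<Longrightarrow> \<phi> \<in> measurable unit_lborel unit_lborel"
  by (simp add: mp_bijections_def)

lemma mp_bijections_range: "\<phi> \<in> mp_bijections \<Longrightarrow> x \<in> {0..1} \<Longrightarrow> \<phi> x \<in> {0..1}"
  using measurable_space[OF mp_bijections_measurable, of \<phi> x] by simp

lemma id_in_mp_bijections: "(\<lambda>x. x) \<in> mp_bijections"
proof -
  have "inv_into {0..1} (\<lambda>x. x) x = x" if "x \<in> {0..1}" for x :: real
    using that inv_into_f_f[of "\<lambda>x. x" "{0..1}" x] by simp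
  then have "inv_into {0..1} (\<lambda>x::real. x) \<in> measurable unit_lborel unit_lborel"
    by (subst measurable_cong[where g = "\<lambda>x. x"]) auto
  moreover have "bij_betw (\<lambda>x. x) {0..1::real} {0..1}"
    using bij_betw_id by (simp add: id_def)
  ultimately show ?thesis
    by (simp add: mp_bijections_def distr_id2)
qed

lemma graphon_comp:
  assumes "graphon W" "\<phi> \<in> mp_bijections"
  shows "graphon (\<lambda>x y. W (\<phi> x) (\<phi> y))"
proof -
  note graphon_measurable[OF assms(1), measurable] mp_bijections_measurable[OF assms(2), measurable]
  have "(\<lambda>(x, y). W (\<phi> x) (\<phi> y)) \<in> borel_measurable unit_square"
    by measurable
  then show ?thesis
    using assms(1) mp_bijections_range[OF assms(2)] unfolding graphon_def by blast
qed

text \<open>Applying a measure-preserving map in both coordinates pushes the product measure forward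
  to the product of the pushforwards, that is, to itself.\<close>

lemma t_edge_comp:
  assumes "graphon W" "\<phi> \<in> mp_bijections"
  shows "t_edge (\<lambda>x y. W (\<phi> x) (\<phi> y)) = t_edge W"
proof -
  note \<phi> [measurable] = mp_bijections_measurable[OF assms(2)]
  have d: "distr unit_lborel unit_lborel \<phi> = unit_lborel"
    using assms(2) by (simp add: mp_bijections_def)
  have "unit_square = distr unit_square unit_square (\<lambda>(x, y). (\<phi> x, \<phi> y))"
    using pair_measure_distr[OF \<phi> \<phi>] unit.sigma_finite_measure_axioms by (simp add: d)
  then have "t_edge W = (\<integral>(x, y). W x y \<partial>distr unit_square unit_square (\<lambda>(x, y). (\<phi> x, \<phi> y)))"
    by (simp add: t_edge_def)
  also have "\<dots> = (\<integral>p. (case (case p of (x, y) \<Rightarrow> (\<phi> x, \<phi> y)) of (x, y) \<Rightarrow> W x y) \<partial>unit_square)"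
    by (intro integral_distr graphon_measurable assms) measurable
  finally show ?thesis
    by (simp add: t_edge_def case_prod_beta')
qed

lemma integrable_graphon_diff:
  assumes "graphon U" "graphon W"
  shows "integrable unit_square (\<lambda>p. U (fst p) (snd p) - W (fst p) (snd p))"
  using t_edge_bounds(3)[OF assms(1)] t_edge_bounds(3)[OF assms(2)] by (simp add: case_prod_beta')

lemma cut_integral_le_L1_dist:
  assumes "graphon U" "graphon W" "S \<in> sets unit_lborel" "T \<in> sets unit_lborel"
  shows "\<bar>LINT p:S \<times> T|unit_square. U (fst p) (snd p) - W (fst p) (snd p)\<bar> \<le> L1_dist U W"
proof -
  note i = integrable_graphon_diff[OF assms(1,2)]
  have m: "S \<times> T \<in> sets unit_square"
    using assms by auto
  have "\<bar>LINT p:S \<times> T|unit_square. U (fst p) (snd p) - W (fst p) (snd p)\<bar>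
    \<le> (\<integral>p. \<bar>indicator (S \<times> T) p *\<^sub>R (U (fst p) (snd p) - W (fst p) (snd p))\<bar> \<partial>unit_square)"
    unfolding set_lebesgue_integral_def by (rule integral_abs_bound)
  also have "\<dots> \<le> (\<integral>p. \<bar>U (fst p) (snd p) - W (fst p) (snd p)\<bar> \<partial>unit_square)"
    using integrable_mult_indicator[OF m i] i
    by (intro integral_mono) (auto split: split_indicator)
  finally show ?thesis
    by (simp add: L1_dist_def case_prod_beta')
qed

lemma bdd_above_cut_integrals:
  assumes "graphon U" "graphon W"
  shows "bdd_above ((\<lambda>(S, T). \<bar>LINT p:S \<times> T|unit_square. U (fst p) (snd p) - W (fst p) (snd p)\<bar>)
    ` (sets unit_lborel \<times> sets unit_lborel))"
  using cut_integral_le_L1_dist[OF assms] by (intro bdd_aboveI[of _ "L1_dist U W"]) auto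

lemma cut_integral_le_cut_norm:
  assumes "graphon U" "graphon W" "S \<in> sets unit_lborel" "T \<in> sets unit_lborel"
  shows "\<bar>LINT p:S \<times> T|unit_square. U (fst p) (snd p) - W (fst p) (snd p)\<bar>
    \<le> cut_norm (\<lambda>x y. U x y - W x y)"
  unfolding cut_norm_def
  using cSUP_upper[OF _ bdd_above_cut_integrals[OF assms(1,2)], of "(S, T)"] assms(3,4) by simp

lemma cut_norm_nonneg:
  assumes "graphon U" "graphon W"
  shows "0 \<le> cut_norm (\<lambda>x y. U x y - W x y)"
  using cut_integral_le_cut_norm[OF assms, of "{}" "{}"] by simp

lemma cut_norm_leI:
  assumes "\<And>S T. S \<in> sets unit_lborel \<Longrightarrow> T \<in> sets unit_lborel \<Longrightarrow>
    \<bar>LINT p:S \<times> T|unit_square. f (fst p) (snd p)\<bar> \<le> c"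
  shows "cut_norm f \<le> c"
  unfolding cut_norm_def using assms sets.empty_sets by (intro cSUP_least) auto

text \<open>The choice S = T = [0, 1] in the supremum gives the difference of the edge
  densities.\<close>

lemma t_edge_diff_le_cut_norm:
  assumes "graphon U" "graphon W"
  shows "\<bar>t_edge U - t_edge W\<bar> \<le> cut_norm (\<lambda>x y. U x y - W x y)"
proof -
  have "t_edge U - t_edge W = (\<integral>p. U (fst p) (snd p) - W (fst p) (snd p) \<partial>unit_square)"
    using t_edge_bounds(3)[OF assms(1)] t_edge_bounds(3)[OF assms(2)]
    by (simp add: t_edge_def case_prod_beta')
  also have "\<dots> = (LINT p:{0..1} \<times> {0..1}|unit_square. U (fst p) (snd p) - W (fst p) (snd p))"
    unfolding set_lebesgue_integral_def
    by (intro Bochner_Integration.integral_cong) (auto simp: space_pair_measure)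
  finally show ?thesis
    using cut_integral_le_cut_norm[OF assms, of "{0..1}" "{0..1}"] sets.top[of unit_lborel] by simp
qed

lemma cut_norm_triangle_L1:
  assumes "graphon U" "graphon V" "graphon W"
  shows "cut_norm (\<lambda>x y. V x y - W x y) \<le> L1_dist V U + cut_norm (\<lambda>x y. U x y - W x y)"
proof (rule cut_norm_leI)
  fix S T assume ST: "S \<in> sets unit_lborel" "T \<in> sets unit_lborel"
  have m: "S \<times> T \<in> sets unit_square"
    using ST by auto
  have "(LINT p:S \<times> T|unit_square. V (fst p) (snd p) - W (fst p) (snd p))
    = (LINT p:S \<times> T|unit_square. (V (fst p) (snd p) - U (fst p) (snd p)) + (U (fst p) (snd p) - W (fst p) (snd p)))"
    by simp
  also have "\<dots> = (LINT p:S \<times> T|unit_square. V (fst p) (snd p) - U (fst p) (snd p))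
      + (LINT p:S \<times> T|unit_square. U (fst p) (snd p) - W (fst p) (snd p))"
    by (intro set_integral_add; unfold set_integrable_def)
      (intro integrable_mult_indicator[OF m] integrable_graphon_diff assms)+
  finally show "\<bar>LINT p:S \<times> T|unit_square. V (fst p) (snd p) - W (fst p) (snd p)\<bar>
    \<le> L1_dist V U + cut_norm (\<lambda>x y. U x y - W x y)"
    using cut_integral_le_L1_dist[OF assms(2,1) ST] cut_integral_le_cut_norm[OF assms(1,3) ST]
    by linarith
qed

lemma cut_dist_le:
  assumes "graphon U" "graphon W" "\<phi> \<in> mp_bijections"
  shows "cut_dist U W \<le> cut_norm (\<lambda>x y. U x y - W (\<phi> x) (\<phi> y))"
proof -
  have "bdd_below ((\<lambda>\<phi>. cut_norm (\<lambda>x y. U x y - W (\<phi> x) (\<phi> y))) ` mp_bijections)"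
    using cut_norm_nonneg[OF assms(1) graphon_comp[OF assms(2)]] by (intro bdd_belowI[of _ 0]) auto
  then show ?thesis
    unfolding cut_dist_def using assms(3) by (rule cINF_lower)
qed

lemma cut_dist_greatest:
  assumes "\<And>\<phi>. \<phi> \<in> mp_bijections \<Longrightarrow> c \<le> cut_norm (\<lambda>x y. U x y - W (\<phi> x) (\<phi> y))"
  shows "c \<le> cut_dist U W"
  unfolding cut_dist_def using assms id_in_mp_bijections by (intro cINF_greatest) auto

lemma cut_dist_nonneg:
  assumes "graphon U" "graphon W"
  shows "0 \<le> cut_dist U W"
  by (rule cut_dist_greatest) (rule cut_norm_nonneg[OF assms(1) graphon_comp[OF assms(2)]])

lemma t_edge_diff_le_cut_dist:
  assumes "graphon U" "graphon W"
  shows "\<bar>t_edge U - t_edge W\<bar> \<le> cut_dist U W"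
  using t_edge_diff_le_cut_norm[OF assms(1) graphon_comp[OF assms(2)]] t_edge_comp[OF assms(2)]
  by (intro cut_dist_greatest) simp

text \<open>The perturbation is in the first argument, on which the bijection does not act, so one
  and the same \<phi> serves both sides.\<close>

lemma cut_dist_triangle_L1:
  assumes "graphon U" "graphon V" "graphon W"
  shows "cut_dist V W \<le> L1_dist V U + cut_dist U W"
proof -
  have "cut_dist V W - L1_dist V U \<le> cut_dist U W"
  proof (rule cut_dist_greatest)
    fix \<phi> assume \<phi>: "\<phi> \<in> mp_bijections"
    show "cut_dist V W - L1_dist V U \<le> cut_norm (\<lambda>x y. U x y - W (\<phi> x) (\<phi> y))"
      using cut_dist_le[OF assms(2,3) \<phi>] cut_norm_triangle_L1[OF assms(1,2) graphon_comp[OF assms(3) \<phi>]]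
      by linarith
  qed
  then show ?thesis by linarith
qed

lemma cut_dist_refl: "graphon W \<Longrightarrow> cut_dist W W = 0"
  using cut_dist_le[OF _ _ id_in_mp_bijections, of W W] cut_dist_nonneg[of W W]
    cut_norm_leI[of "\<lambda>_ _. 0" 0] by (simp add: set_lebesgue_integral_def)

section \<open>Classes, representatives and constant graphons\<close>

lemma graphon_rep:
  assumes "C \<in> graphon_space"
  shows "graphon (rep C)"
proof -
  obtain W where W: "graphon W" "C = graphon_rel `` {W}"
    using assms by (auto simp: graphon_space_def elim: quotientE)
  then have "W \<in> C"
    by (simp add: graphon_rel_def cut_dist_refl)
  then have "rep C \<in> C"
    unfolding rep_def by (rule someI[of "\<lambda>W. W \<in> _"])
  then show ?thesis
    using W by (simp add: graphon_rel_def)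
qed

lemma class_of_in_graphon_space: "graphon W \<Longrightarrow> class_of W \<in> graphon_space"
  by (auto simp: graphon_space_def class_of_def intro: quotientI)

lemma cut_dist_rep_class_of:
  assumes "graphon W"
  shows "cut_dist W (rep (class_of W)) = 0"
proof -
  have "W \<in> class_of W"
    using assms by (simp add: class_of_def graphon_rel_def cut_dist_refl)
  then have "rep (class_of W) \<in> class_of W"
    unfolding rep_def by (rule someI[of "\<lambda>W. W \<in> _"])
  then show ?thesis
    by (subst (asm) (2) class_of_def) (simp add: graphon_rel_def)
qed

text \<open>Of the chosen representative it is only known that its cut distance to W is 0. The edge
  density is 1-Lipschitz in the cut distance, hence carries over.\<close>

lemma t_edge_rep_class_of:
  assumes "graphon W"
  shows "t_edge (rep (class_of W)) = t_edge W"
  using t_edge_diff_le_cut_dist[OF assms graphon_rep[OF class_of_in_graphon_space[OF assms]]]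
  by (simp add: cut_dist_rep_class_of[OF assms])

text \<open>U is at cut distance 0 from the representative of its class, so moving from
  \<open>rep C\<close> to U in \<open>L1_dist\<close> is the only cost.\<close>

lemma class_dist_class_of_le:
  assumes "C \<in> graphon_space" "graphon U"
  shows "class_dist C (class_of U) \<le> L1_dist (rep C) U"
  using cut_dist_triangle_L1[OF assms(2) graphon_rep[OF assms(1)]
      graphon_rep[OF class_of_in_graphon_space[OF assms(2)]]]
  by (simp add: class_dist_def cut_dist_rep_class_of[OF assms(2)])

lemma class_setdist_le:
  assumes "C \<in> graphon_space" "graphon U" "class_of U \<in> A" "A \<subseteq> graphon_space"
  shows "class_setdist C A \<le> L1_dist (rep C) U"
proof -
  have "bdd_below (class_dist C ` A)"
    using assms(1,4) by (intro bdd_belowI[of _ 0])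
      (auto simp: class_dist_def intro!: cut_dist_nonneg graphon_rep)
  then have "class_setdist C A \<le> class_dist C (class_of U)"
    unfolding class_setdist_def using assms(3) by (rule cINF_lower)
  then show ?thesis
    using class_dist_class_of_le[OF assms(1,2)] by linarith
qed

lemma graphon_const: "0 \<le> c \<Longrightarrow> c \<le> 1 \<Longrightarrow> graphon (\<lambda>x y. c)"
  by (simp add: graphon_def)

lemma t_edge_const: "t_edge (\<lambda>x y. c) = c"
  using square.prob_space by (simp add: t_edge_def case_prod_beta')

lemma L1_dist_const_0: "graphon W \<Longrightarrow> L1_dist W (\<lambda>x y. 0) = t_edge W"
  unfolding L1_dist_def t_edge_def using graphon_bounds[of W]
  by (intro Bochner_Integration.integral_cong) (auto simp: space_pair_measure)

lemma L1_dist_const_1: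
  assumes "graphon W"
  shows "L1_dist W (\<lambda>x y. 1) = 1 - t_edge W"
proof -
  have "L1_dist W (\<lambda>x y. 1) = (\<integral>p. 1 - (case p of (x, y) \<Rightarrow> W x y) \<partial>unit_square)"
    unfolding L1_dist_def using graphon_bounds[OF assms]
    by (intro Bochner_Integration.integral_cong) (auto simp: space_pair_measure)
  then show ?thesis
    using t_edge_bounds(3)[OF assms] square.prob_space by (simp add: t_edge_def)
qed

lemma limit_classes_subset: "limit_classes \<beta>1 \<subseteq> graphon_space"
  by (auto simp: limit_classes_def cluster_classes_def cluster_graphon_def
      intro!: class_of_in_graphon_space graphon_const)

section \<open>Energy for very negative \<beta>2\<close>

definition energy :: "real \<Rightarrow> real \<Rightarrow> (real \<Rightarrow> real \<Rightarrow> real) \<Rightarrow> real" where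
  "energy \<beta>1 \<beta>2 W = T_wedge \<beta>1 \<beta>2 W - 1 / 2 * graphon_entropy W"

text \<open>A cherry density above \<epsilon> would cost at least \<bar>\<beta>1\<bar> + 1, whereas
  the edge term gains at most \<bar>\<beta>1\<bar> and the entropy term less than 1; the energy
  would be negative.\<close>

lemma energy_nonneg_imp_cherry_small:
  assumes "0 < \<epsilon>" "\<beta>2 \<le> - ((\<bar>\<beta>1\<bar> + 1) / \<epsilon>)" "graphon W" "0 \<le> energy \<beta>1 \<beta>2 W"
  shows "t_ind_cherry W \<le> \<epsilon>"
proof (rule ccontr)
  assume "\<not> t_ind_cherry W \<le> \<epsilon>"
  have "(\<bar>\<beta>1\<bar> + 1) / \<epsilon> * \<epsilon> \<le> - \<beta>2 * \<epsilon>"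
    using assms(1,2) by (intro mult_right_mono) auto
  also have "\<dots> \<le> - \<beta>2 * t_ind_cherry W"
  proof (rule mult_left_mono)
    have "0 \<le> (\<bar>\<beta>1\<bar> + 1) / \<epsilon>" using assms(1) by simp
    then show "0 \<le> - \<beta>2" using assms(2) by linarith
  qed (use \<open>\<not> t_ind_cherry W \<le> \<epsilon>\<close> in simp)
  finally have 1: "\<bar>\<beta>1\<bar> + 1 \<le> - (\<beta>2 * t_ind_cherry W)"
    using assms(1) by simp
  have "\<beta>1 * t_edge W \<le> \<bar>\<beta>1\<bar> * 1"
    using t_edge_bounds[OF assms(3)] by (intro mult_mono) auto
  moreover have "- graphon_entropy W < 2"
    using graphon_entropy_bounds(2)[OF assms(3)] ln_2_less_1 by linarith
  ultimately show False
    using 1 assms(4) by (simp add: energy_def T_wedge_def)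
qed

lemma energy_le:
  assumes "\<beta>2 \<le> 0" "graphon W" "- \<delta> \<le> graphon_entropy W"
  shows "energy \<beta>1 \<beta>2 W \<le> \<beta>1 * t_edge W + \<delta> / 2"
proof -
  have "\<beta>2 * t_ind_cherry W \<le> 0"
    using assms(1) t_ind_cherry_bounds(1)[OF assms(2)] by (rule mult_nonpos_nonneg)
  then show ?thesis
    using assms(3) by (simp add: energy_def T_wedge_def)
qed

text \<open>Edge density 0 or 1 leaves no cherries, so the term with \<beta>2 drops out, and the
  entropy term can only add. An inequality is stated because the representative need not itself be
  constant.\<close>

lemma energy_const_class:
  assumes "c = 0 \<or> c = 1"
  shows "\<beta>1 * c \<le> energy \<beta>1 \<beta>2 (rep (class_of (\<lambda>x y. c)))"
proof -
  have c: "graphon (\<lambda>x y. c)"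
    using assms by (auto intro: graphon_const)
  define V where "V = rep (class_of (\<lambda>x y. c))"
  have V: "graphon V" "t_edge V = c"
    using graphon_rep[OF class_of_in_graphon_space[OF c]] t_edge_rep_class_of[OF c]
    by (simp_all add: V_def t_edge_const)
  then have "t_ind_cherry V = 0"
    using t_ind_cherry_bounds[OF V(1)] assms by auto
  then show ?thesis
    using V graphon_entropy_bounds(1)[OF V(1)] by (simp add: energy_def T_wedge_def flip: V_def)
qed

text \<open>The better of the two constant classes works, and the same one for all \<beta>2, as its
  representative has no cherries.\<close>

lemma energy_lower_bound:
  obtains C where "C \<in> graphon_space" "\<And>\<beta>2. max 0 \<beta>1 \<le> energy \<beta>1 \<beta>2 (rep C)"
proof (rule that[of "class_of (\<lambda>x y. if \<beta>1 \<le> 0 then 0 else 1)"])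
  show "class_of (\<lambda>x y. if \<beta>1 \<le> 0 then 0 else 1) \<in> graphon_space"
    by (intro class_of_in_graphon_space graphon_const) auto
  show "max 0 \<beta>1 \<le> energy \<beta>1 \<beta>2 (rep (class_of (\<lambda>x y. if \<beta>1 \<le> 0 then 0 else 1)))" for \<beta>2
    using energy_const_class[of 0 \<beta>1 \<beta>2] energy_const_class[of 1 \<beta>1 \<beta>2] by auto
qed

lemma free_energy_eq: "free_energy \<beta>1 \<beta>2 C = energy \<beta>1 \<beta>2 (rep C)"
  by (simp add: free_energy_def energy_def)

text \<open>Collects both consequences of a small cherry density, uniformly in W. Nonnegative energy
  is what makes the cherry density small; the constant classes show that maximizers satisfy
  it.\<close>

lemma eventually_energy_bounds:
  assumes "0 < \<delta>"
  shows "\<forall>\<^sub>F \<beta>2 in at_bot. \<forall>W. graphon W \<longrightarrow> 0 \<le> energy \<beta>1 \<beta>2 W \<longrightarrow>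
    energy \<beta>1 \<beta>2 W \<le> \<beta>1 * t_edge W + \<delta> \<and>
    (\<exists>A. (\<forall>i. A i \<in> sets unit_lborel) \<and> disjoint_family A \<and> L1_dist W (cluster_fun A) \<le> \<delta>)"
proof -
  \<comment> \<open>The bound is 2 \<delta> because the entropy enters the energy with the factor
    1/2.\<close>
  obtain \<epsilon>1 where \<epsilon>1: "0 < \<epsilon>1" "\<And>W. graphon W \<Longrightarrow> t_ind_cherry W \<le> \<epsilon>1 \<Longrightarrow> - (2 * \<delta>) \<le> graphon_entropy W"
  proof (rule t_ind_cherry_small_imp_entropy_small)
    show "0 < 2 * \<delta>" using assms by simp
  qed (rule that)
  obtain \<epsilon>2 where \<epsilon>2: "0 < \<epsilon>2" "\<And>W. graphon W \<Longrightarrow> t_ind_cherry W \<le> \<epsilon>2 \<Longrightarrow>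
    \<exists>A. (\<forall>i. A i \<in> sets unit_lborel) \<and> disjoint_family A \<and> L1_dist W (cluster_fun A) \<le> \<delta>"
    by (rule t_ind_cherry_small_imp_near_cluster[OF assms]) (rule that)
  have "\<forall>\<^sub>F \<beta>2 in at_bot. \<beta>2 \<le> 0 \<and> \<beta>2 \<le> - ((\<bar>\<beta>1\<bar> + 1) / min \<epsilon>1 \<epsilon>2)"
    by (intro eventually_conj eventually_le_at_bot)
  then show ?thesis
  proof eventually_elim
    case (elim \<beta>2)
    show ?case
    proof (intro allI impI)
      fix W assume W: "graphon W" "0 \<le> energy \<beta>1 \<beta>2 W"
      have "t_ind_cherry W \<le> min \<epsilon>1 \<epsilon>2"
        using energy_nonneg_imp_cherry_small[of "min \<epsilon>1 \<epsilon>2" \<beta>2 \<beta>1 W] W elim \<epsilon>1(1) \<epsilon>2(1) by auto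
      then have t: "t_ind_cherry W \<le> \<epsilon>1" "t_ind_cherry W \<le> \<epsilon>2" by auto
      show "energy \<beta>1 \<beta>2 W \<le> \<beta>1 * t_edge W + \<delta> \<and>
          (\<exists>A. (\<forall>i. A i \<in> sets unit_lborel) \<and> disjoint_family A \<and> L1_dist W (cluster_fun A) \<le> \<delta>)"
        using energy_le[of \<beta>2 W "2 * \<delta>" \<beta>1] elim W(1) \<epsilon>1(2)[OF W(1) t(1)] \<epsilon>2(2)[OF W(1) t(2)] by auto
    qed
  qed
qed

section \<open>Limits of the maximum and of the maximizers\<close>

text \<open>The constant classes bound the supremum from below. For the upper bound, a graphon of
  negative energy is already below the limit, and for the others \<beta>1 times an edge density in
  [0, 1] is at most max 0 \<beta>1.\<close>

lemma psi_wedge_tendsto: "(psi_wedge \<beta>1 \<longlongrightarrow> max 0 \<beta>1) at_bot"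
proof (rule tendstoI)
  fix e :: real assume "0 < e"
  then have "0 < e / 2" by simp
  from eventually_energy_bounds[OF this, of \<beta>1]
  show "\<forall>\<^sub>F \<beta>2 in at_bot. dist (psi_wedge \<beta>1 \<beta>2) (max 0 \<beta>1) < e"
  proof eventually_elim
    case (elim \<beta>2)
    have le: "free_energy \<beta>1 \<beta>2 C \<le> max 0 \<beta>1 + e / 2" if "C \<in> graphon_space" for C
    proof (cases "0 \<le> energy \<beta>1 \<beta>2 (rep C)")
      case True
      have g: "graphon (rep C)" using that by (rule graphon_rep)
      have "\<beta>1 * t_edge (rep C) \<le> max 0 \<beta>1 * 1"
        using t_edge_bounds[OF g] by (intro mult_mono) auto
      then show ?thesis
        using elim g True by (fastforce simp: free_energy_eq)
    qed (use \<open>0 < e\<close> in \<open>auto simp: free_energy_eq\<close>)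
    obtain C where C: "C \<in> graphon_space" "\<And>\<beta>2. max 0 \<beta>1 \<le> energy \<beta>1 \<beta>2 (rep C)"
      by (rule energy_lower_bound[of \<beta>1]) (rule that)
    have "bdd_above (free_energy \<beta>1 \<beta>2 ` graphon_space)"
      using le by (intro bdd_aboveI[of _ "max 0 \<beta>1 + e / 2"]) auto
    then have "free_energy \<beta>1 \<beta>2 C \<le> psi_wedge \<beta>1 \<beta>2"
      unfolding psi_wedge_def using C(1) by (intro cSUP_upper)
    then have "max 0 \<beta>1 \<le> psi_wedge \<beta>1 \<beta>2"
      using C(2)[of \<beta>2] by (simp add: free_energy_eq)
    moreover have "psi_wedge \<beta>1 \<beta>2 \<le> max 0 \<beta>1 + e / 2"
      unfolding psi_wedge_def using le C(1) by (intro cSUP_least) auto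
    ultimately show ?case
      using \<open>0 < e\<close> by (simp add: dist_real_def)
  qed
qed

text \<open>A maximizer has energy at least max 0 \<beta>1 and at most \<beta>1 t + \<delta>, where
  t is its edge density. For \<beta>1 < 0 this forces t to be small, for \<beta>1 > 0 it forces 1 -
  t to be small, and these are the values of \<open>L1_dist\<close> to the constants 0 and 1. For
  \<beta>1 = 0 nearness to a cluster graphon is all that remains.\<close>

lemma eventually_maximizers_near_limit_classes:
  assumes "0 < e"
  shows "\<forall>\<^sub>F \<beta>2 in at_bot. \<forall>C \<in> maximizers \<beta>1 \<beta>2. class_setdist C (limit_classes \<beta>1) \<le> e"
proof -
  \<comment> \<open>For nonzero \<beta>1 the energy comparison is divided by \<bar>\<beta>1\<bar>,
    which turns this \<delta> into e; for \<beta>1 = 0 the distance to a cluster graphon is bounded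
    by \<delta> directly.\<close>
  define \<delta> where "\<delta> = (if \<beta>1 = 0 then e else e * \<bar>\<beta>1\<bar>)"
  have "0 < \<delta>"
    using assms by (simp add: \<delta>_def)
  from eventually_energy_bounds[OF this, of \<beta>1]
  show ?thesis
  proof eventually_elim
    case (elim \<beta>2)
    show ?case
    proof
      fix C assume "C \<in> maximizers \<beta>1 \<beta>2"
      then have C: "C \<in> graphon_space" and max: "\<And>D. D \<in> graphon_space \<Longrightarrow> energy \<beta>1 \<beta>2 (rep D) \<le> energy \<beta>1 \<beta>2 (rep C)"
        by (auto simp: maximizers_def free_energy_eq)
      have g: "graphon (rep C)"
        using C by (rule graphon_rep)
      have "max 0 \<beta>1 \<le> energy \<beta>1 \<beta>2 (rep C)"
        using energy_lower_bound[of \<beta>1] max by (metis order_trans)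
      then have le: "max 0 \<beta>1 \<le> \<beta>1 * t_edge (rep C) + \<delta>"
        and near: "\<exists>A. (\<forall>i. A i \<in> sets unit_lborel) \<and> disjoint_family A \<and> L1_dist (rep C) (cluster_fun A) \<le> \<delta>"
        using elim g by (force, force)
      have "\<exists>U. graphon U \<and> class_of U \<in> limit_classes \<beta>1 \<and> L1_dist (rep C) U \<le> e"
      proof (cases \<beta>1 "0::real" rule: linorder_cases)
        case less
        then have "\<bar>\<beta>1\<bar> * t_edge (rep C) \<le> \<bar>\<beta>1\<bar> * e"
          using le by (simp add: \<delta>_def algebra_simps)
        then have "L1_dist (rep C) (\<lambda>x y. 0) \<le> e"
          using less by (simp add: L1_dist_const_0[OF g] mult_le_cancel_left)
        then show ?thesis
          using less graphon_const[of 0] by (auto simp: limit_classes_def)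
      next
        case equal
        from near obtain A where A: "\<And>i. A i \<in> sets unit_lborel" "disjoint_family A"
          and L: "L1_dist (rep C) (cluster_fun A) \<le> \<delta>"
          by blast
        have "cluster_graphon (cluster_fun A)"
          by (rule cluster_graphon_cluster_fun[OF A])
        then show ?thesis
          using L equal unfolding limit_classes_def cluster_classes_def
          by (intro exI[of _ "cluster_fun A"]) (auto simp: cluster_graphon_def \<delta>_def)
      next
        case greater
        then have "\<beta>1 * (1 - t_edge (rep C)) \<le> \<beta>1 * e"
          using le by (simp add: \<delta>_def algebra_simps)
        then have "L1_dist (rep C) (\<lambda>x y. 1) \<le> e"
          using greater by (simp add: L1_dist_const_1[OF g])
        then show ?thesis
          using greater graphon_const[of 1] by (auto simp: limit_classes_def)
      qed
      then show "class_setdist C (limit_classes \<beta>1) \<le> e"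
        using class_setdist_le[OF C _ _ limit_classes_subset] by force
    qed
  qed
qed

theorem theorem3p30:
  fixes \<beta>1 :: real
  shows "((\<lambda>\<beta>2. SUP C \<in> maximizers \<beta>1 \<beta>2. ennreal (class_setdist C (limit_classes \<beta>1))) \<longlongrightarrow> 0) at_bot
    \<and> (\<beta>1 \<le> 0 \<longrightarrow> (psi_wedge \<beta>1 \<longlongrightarrow> 0) at_bot)
    \<and> (\<beta>1 > 0 \<longrightarrow> (psi_wedge \<beta>1 \<longlongrightarrow> \<beta>1) at_bot)"
proof (intro conjI impI)
  show "((\<lambda>\<beta>2. SUP C \<in> maximizers \<beta>1 \<beta>2. ennreal (class_setdist C (limit_classes \<beta>1))) \<longlongrightarrow> 0) at_bot"
  proof (rule order_tendstoI)
    fix a :: ennreal assume "0 < a"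
    \<comment> \<open>An intermediate b is finite, being below a, and leaves room for the strict
      inequality after bounding the supremum by b. The supremum in \<open>ennreal\<close> over an
      empty set of maximizers would be 0, so that case needs no separate treatment.\<close>
    then obtain b where b: "0 < b" "b < a"
      using dense by blast
    then obtain e where e: "0 < e" "b = ennreal e"
      by (cases b) (auto simp: ennreal_zero_less_top)
    from eventually_maximizers_near_limit_classes[OF e(1), of \<beta>1]
    show "\<forall>\<^sub>F \<beta>2 in at_bot. (SUP C \<in> maximizers \<beta>1 \<beta>2. ennreal (class_setdist C (limit_classes \<beta>1))) < a"
    proof eventually_elim
      case (elim \<beta>2)
      then have "(SUP C \<in> maximizers \<beta>1 \<beta>2. ennreal (class_setdist C (limit_classes \<beta>1))) \<le> b"
        unfolding e(2) by (intro SUP_least ennreal_leI) auto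
      then show ?case
        using b(2) by (rule le_less_trans)
    qed
  qed simp
  show "(psi_wedge \<beta>1 \<longlongrightarrow> 0) at_bot" if "\<beta>1 \<le> 0"
    using psi_wedge_tendsto[of \<beta>1] that by (simp add: max_absorb1)
  show "(psi_wedge \<beta>1 \<longlongrightarrow> \<beta>1) at_bot" if "\<beta>1 > 0"
    using psi_wedge_tendsto[of \<beta>1] that by (simp add: max_def)
qed

end
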